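(* Let $N\ge 1$, let $\{S^e\}_{e=1}^E$ be a non-overlapping partition of $\mathbb S^2$ into elements that are rectangles $S^e=[\theta_{s-1},\theta_s]\times[\varphi_{t-1},\varphi_t]$ in the $(\theta,\varphi)$-coordinates ($s=s(e)$, $t=t(e)$), let $\{u_{ij}^e\}_{0\le i,j\le N,\,1\le e\le E}$ be given nodal values, and let $u_N^E$ be the piecewise function on $\mathbb S^2$ given on each element by $$u_N^E|_{S^e}(\theta,\varphi)=\sum_{i=0}^N\sum_{j=0}^N u_{ij}^e\,\psi_{ij}(\mathcal F_e^{-1}(\theta,\varphi)).$$ Then for all integers $l\ge 0$ and $|m|\le l$, the spherical harmonic coefficient of $u_N^E$ is $$\tilde a_l^m:=\int_{\mathbb S^2}u_N^E(\theta,\varphi)\,\overline{Y_l^m(\theta,\varphi)}\,dS=\sum_{e=1}^E\sum_{i=0}^N\sum_{j=0}^N u_{ij}^e\,\mathfrak a_{m,i}^t\,\mathfrak b_{l,m,j}^s ,$$ where $$\mathfrak a_{m,i}^t=\begin{cases}2v_{i0}\,\hat\varphi_t\,e^{-\mathrm i m\beta_t}, & m=0,\\ \hat\varphi_t\,e^{-\mathrm i m\beta_t}\sum_{n=0}^N 2\,\mathrm i^{-n}v_{in}\,j_n(m\hat\varphi_t), & m\ne 0,\end{cases}\qquad \mathfrak b_{l,m,j}^s=\hat\theta_s\sum_{n=0}^N v_{jn}\,\mathscr Q^n_{lm}(\hat\theta_s,\alpha_s),$$ and $$\mathscr Q^n_{lm}(\lambda,\rho):=\int_{-1}^1P_n(x)\,\widehat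 P_l^m(\cos(\lambda x+\rho))\sin(\lambda x+\rho)\,dx$$ ($\lambda,\rho\in\mathbb R$) can be computed by $$\mathscr Q^n_{lm}(\lambda,\rho)=\begin{cases} \frac12\sum_{k=0}^{l/2}A_{lm}^k\big[\mathscr S_n(p_k\lambda,p_k\rho)-\mathscr S_n(p_{k-1}\lambda,p_{k-1}\rho)\big], & l \text{ even},\ m\text{ even},\\ \frac12\sum_{k=1}^{l/2}A_{lm}^k\big[\mathscr C_n(p_{k-1}\lambda,p_{k-1}\rho)-\mathscr C_n(p_k\lambda,p_k\rho)\big], & l \text{ even},\ m\text{ odd},\\ \frac12\sum_{k=1}^{(l+1)/2}A_{lm}^k\big[\mathscr S_n(q_k\lambda,q_k\rho)-\mathscr S_n(q_{k-1}\lambda,q_{k-1}\rho)\big], & l \text{ odd},\ m\text{ even},\\ \frac12\sum_{k=1}^{(l+1)/2}A_{lm}^k\big[\mathscr C_n(q_{k-1}\lambda,q_{k-1}\rho)-\mathscr C_n(q_k\lambda,q_k\rho)\big], & l \text{ odd},\ m\text{ odd}, \end{cases}$$ with $p_k:=2k+1$, $q_k:=2k$, and $$\mathscr C_n(\lambda,\rho)=\begin{cases}2\delta_{n0}\cos\rho,&\lambda=0,\\ 2j_n(\lambda)\big(\mathrm{Re}\{\mathrm i^{-n}\}\cos\rho+\mathrm{Im}\{\mathrm i^{-n}\}\sin\rho\big),&\lambda\ne0,\end{cases}$$ $$\mathscr S_n(\lambda,\rho)=\begin{cases}2\delta_{n0}\sin\rho,&\lambda=0,\\ 2j_n(\lambda)\big(\mathrm{Re}\{\mathrm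 i^{-n}\}\sin\rho-\mathrm{Im}\{\mathrm i^{-n}\}\cos\rho\big),&\lambda\ne0.\end{cases}$$
   Context: Spherical coordinates on the unit sphere $\mathbb S^2$: $\theta\in[0,\pi]$ is the polar angle, $\varphi\in[0,2\pi)$ the azimuthal angle, $dS=\sin\theta\,d\theta\,d\varphi$. Legendre functions and spherical harmonics: $P_l$ is the Legendre polynomial of degree $l$. For $0\le m\le l$, $P_l^m(x)=(-1)^m(1-x^2)^{m/2}\frac{d^m}{dx^m}P_l(x)$, and $P_l^{-m}=(-1)^m\frac{(l-m)!}{(l+m)!}P_l^m$ for $0<m\le l$. For $|m|\le l$, $\widehat P_l^m:=(-1)^mc_l^mP_l^m$ with $c_l^m=\sqrt{\frac{2l+1}{4\pi}\frac{(l-m)!}{(l+m)!}}$, and $Y_l^m(\theta,\varphi)=\widehat P_l^m(\cos\theta)e^{\mathrm i m\varphi}$. Trigonometric coefficients $A_{lm}^k$: they are the coefficients in the expansions $\widehat P_l^m(\cos\theta)=\sum_{k=0}^{l/2}A_{lm}^k\cos(2k\theta)$ ($l$ even, $m$ even); $\widehat P_l^m(\cos\theta)=\sum_{k=1}^{l/2}A_{lm}^k\sin(2k\theta)$ ($l$ even, $m$ odd); $\widehat P_l^m(\cos\theta)=\sum_{k=1}^{(l+1)/2}A_{lm}^k\cos((2k-1)\theta)$ ($l$ odd, $m$ even); $\widehat P_l^m(\cos\theta)=\sum_{k=1}^{(l+1)/2}A_{lm}^k\sin((2k-1)\theta)$ ($l$ odd, $m$ odd). Spectral-element setting: for an element $S^e=[\theta_{s-1},\theta_s]\times[\varphi_{t-1},\varphi_t]$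 set $\hat\theta_s=\frac{\theta_s-\theta_{s-1}}2$, $\alpha_s=\frac{\theta_{s-1}+\theta_s}2$, $\hat\varphi_t=\frac{\varphi_t-\varphi_{t-1}}2$, $\beta_t=\frac{\varphi_{t-1}+\varphi_t}2$. The elemental mapping $\mathcal F_e:[-1,1]^2\to S^e$ is $\mathcal F_e(\eta,\xi)=(\hat\theta_s\eta+\alpha_s,\ \hat\varphi_t\xi+\beta_t)$. Let $\{\xi_i\}_{i=0}^N$ be the Legendre–Gauss–Lobatto points on $[-1,1]$ (the zeros of $(1-x^2)P_N'(x)$), $\{l_i\}_{i=0}^N$ the Lagrange interpolating basis polynomials of degree $N$ at these points, and $\psi_{ij}(\eta,\xi)=l_i(\xi)l_j(\eta)$. The numbers $v_{in}$ are the Legendre coefficients of the Lagrange basis: $l_i(\xi)=\sum_{n=0}^Nv_{in}P_n(\xi)$. $j_n$ is the spherical Bessel function of the first kind (an entire function, so it is defined at negative arguments), and $\delta_{n0}$ is the Kronecker delta.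
   Formalization: For odd m the closed formula for Q is false for some real λ, ρ (l=m=1, n=0, λ=π, ρ=0), so it is proved where sin(λx+ρ)≥0 on [-1,1], and for all real λ, ρ with (1-cos²)^{m/2} read as sin^m. *)

theory Defs
  imports "HOL-Analysis.Analysis" "HOL-Computational_Algebra.Polynomial"
begin

section \<open>Legendre functions and spherical harmonics\<close>

text \<open>Rodrigues' formula.\<close>
definition legendre :: "nat \<Rightarrow> real poly" where
  "legendre l = smult (1 / (2 ^ l * fact l)) ((pderiv ^^ l) ([:-1, 0, 1:] ^ l))"

text \<open>
  The power \<open>(1 - x\<^sup>2)\<^bsup>m/2\<^esup>\<close> is \<open>sqrt (1 - x\<^sup>2) ^ m\<close> rather than \<open>powr\<close>, since \<open>0 powr 0 = 0\<close>.
\<close>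
definition assoc_legendre_nonneg :: "nat \<Rightarrow> nat \<Rightarrow> real \<Rightarrow> real" where
  "assoc_legendre_nonneg l m x =
     (-1) ^ m * sqrt (1 - x\<^sup>2) ^ m * poly ((pderiv ^^ m) (legendre l)) x"

definition assoc_legendre :: "nat \<Rightarrow> int \<Rightarrow> real \<Rightarrow> real" where
  "assoc_legendre l m x =
     (if 0 \<le> m then assoc_legendre_nonneg l (nat m) x
      else (-1) ^ nat (- m) * (fact (l - nat (- m)) / fact (l + nat (- m)))
             * assoc_legendre_nonneg l (nat (- m)) x)"

definition harmonic_norm :: "nat \<Rightarrow> int \<Rightarrow> real" where
  "harmonic_norm l m =
     sqrt ((2 * real l + 1) / (4 * pi) * (fact (nat (int l - m)) / fact (nat (int l + m))))"

definition hatP :: "nat \<Rightarrow> int \<Rightarrow> real \<Rightarrow> real" where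
  "hatP l m x = (-1) powi m * harmonic_norm l m * assoc_legendre l m x"

definition sph_harmonic :: "nat \<Rightarrow> int \<Rightarrow> real \<Rightarrow> real \<Rightarrow> complex" where
  "sph_harmonic l m th ph = of_real (hatP l m (cos th)) * exp (\<i> * of_int m * of_real ph)"

text \<open>
  Integration over the unit sphere in spherical coordinates, \<open>dS = sin th dth dph\<close>. The completed
  Lebesgue measure is used, so that values on null sets (element boundaries) play no role.
\<close>
definition sphere_integral :: "(real \<times> real \<Rightarrow> complex) \<Rightarrow> complex" where
  "sphere_integral f =
     set_lebesgue_integral lebesgue ({0..pi} \<times> {0..<2 * pi}) (\<lambda>(th, ph). f (th, ph) * of_real (sin th))"

definition sph_coeff :: "(real \<times> real \<Rightarrow> complex) \<Rightarrow> nat \<Rightarrow> int \<Rightarrow> complex" where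
  "sph_coeff u l m = sphere_integral (\<lambda>(th, ph). u (th, ph) * cnj (sph_harmonic l m th ph))"


section \<open>Trigonometric coefficients\<close>

definition trig_index :: "nat \<Rightarrow> int \<Rightarrow> nat set" where
  "trig_index l m =
     (if even l then (if even m then {0..l div 2} else {1..l div 2}) else {1..(l + 1) div 2})"

definition trig_sum :: "nat \<Rightarrow> int \<Rightarrow> (nat \<Rightarrow> real) \<Rightarrow> real \<Rightarrow> real" where
  "trig_sum l m a th =
     (if even l then
        (if even m then (\<Sum>k\<in>trig_index l m. a k * cos (2 * real k * th))
         else (\<Sum>k\<in>trig_index l m. a k * sin (2 * real k * th)))
      else
        (if even m then (\<Sum>k\<in>trig_index l m. a k * cos ((2 * real k - 1) * th))
         else (\<Sum>k\<in>trig_index l m. a k * sin ((2 * real k - 1) * th))))"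

text \<open>
  The expansion is required for polar angles in \<open>[0, \<pi>]\<close> only: for odd \<open>m\<close> it fails where
  \<open>sin th < 0\<close>, because \<open>sqrt (1 - cos th ^ 2) = \<bar>sin th\<bar>\<close>.
\<close>
definition trig_coeff :: "nat \<Rightarrow> int \<Rightarrow> nat \<Rightarrow> real" where
  "trig_coeff l m =
     (THE a. (\<forall>k. k \<notin> trig_index l m \<longrightarrow> a k = 0) \<and>
             (\<forall>th\<in>{0..pi}. hatP l m (cos th) = trig_sum l m a th))"


section \<open>Spherical Bessel functions\<close>

text \<open>
  \<open>j\<^sub>n(x) = sqrt (\<pi> / (2 x)) J\<^bsub>n+1/2\<^esub>(x)\<close> with the power series of the Bessel function \<open>J\<close> inserted;
  the fractional powers of \<open>x\<close> cancel, which gives the entire function, here on the real axis.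
\<close>
definition sph_bessel :: "nat \<Rightarrow> real \<Rightarrow> real" where
  "sph_bessel n x =
     sqrt pi / 2 *
       (\<Sum>k. (-1) ^ k / (fact k * Gamma (real k + real n + 3 / 2)) * (x / 2) ^ (n + 2 * k))"


section \<open>Spectral elements\<close>

definition lgl_points :: "nat \<Rightarrow> real set" where
  "lgl_points N = {x \<in> {-1..1}. (1 - x\<^sup>2) * poly (pderiv (legendre N)) x = 0}"

definition lagrange_basis :: "nat \<Rightarrow> (nat \<Rightarrow> real) \<Rightarrow> nat \<Rightarrow> real poly" where
  "lagrange_basis N xi i = (\<Prod>j\<in>{0..N} - {i}. smult (1 / (xi i - xi j)) [:- xi j, 1:])"

definition legendre_coeffs :: "nat \<Rightarrow> real poly \<Rightarrow> nat \<Rightarrow> real" where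
  "legendre_coeffs N f =
     (THE v. (\<forall>n>N. v n = 0) \<and> f = (\<Sum>n=0..N. smult (v n) (legendre n)))"

definition lagrange_coeff :: "nat \<Rightarrow> (nat \<Rightarrow> real) \<Rightarrow> nat \<Rightarrow> nat \<Rightarrow> real" where
  "lagrange_coeff N xi i n = legendre_coeffs N (lagrange_basis N xi i) n"

definition nodal_basis :: "nat \<Rightarrow> (nat \<Rightarrow> real) \<Rightarrow> nat \<Rightarrow> nat \<Rightarrow> real \<times> real \<Rightarrow> real" where
  "nodal_basis N xi i j = (\<lambda>(eta, x). poly (lagrange_basis N xi i) x * poly (lagrange_basis N xi j) eta)"

definition half_width :: "(nat \<Rightarrow> real) \<Rightarrow> nat \<Rightarrow> real" where
  "half_width g k = (g k - g (k - 1)) / 2"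

definition centre :: "(nat \<Rightarrow> real) \<Rightarrow> nat \<Rightarrow> real" where
  "centre g k = (g (k - 1) + g k) / 2"

definition element :: "(nat \<Rightarrow> real) \<Rightarrow> (nat \<Rightarrow> real) \<Rightarrow> nat \<Rightarrow> nat \<Rightarrow> (real \<times> real) set" where
  "element th ph s t = {th (s - 1)..th s} \<times> {ph (t - 1)..ph t}"

definition element_map :: "(nat \<Rightarrow> real) \<Rightarrow> (nat \<Rightarrow> real) \<Rightarrow> nat \<Rightarrow> nat \<Rightarrow> real \<times> real \<Rightarrow> real \<times> real" where
  "element_map th ph s t =
     (\<lambda>(eta, x). (half_width th s * eta + centre th s, half_width ph t * x + centre ph t))"

definition element_map_inv :: "(nat \<Rightarrow> real) \<Rightarrow> (nat \<Rightarrow> real) \<Rightarrow> nat \<Rightarrow> nat \<Rightarrow> real \<times> real \<Rightarrow> real \<times> real" where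
  "element_map_inv th ph s t = inv_into ({-1..1} \<times> {-1..1}) (element_map th ph s t)"

text \<open>
  The elements are closed, so non-overlapping means disjoint interiors. The breakpoints
  \<open>th, ph\<close> need not be monotone as sequences: any partition of the coordinate rectangle into
  rectangles is covered, tensor-product grids being a special case.
\<close>
definition sphere_partition ::
  "nat \<Rightarrow> (nat \<Rightarrow> real) \<Rightarrow> (nat \<Rightarrow> real) \<Rightarrow> (nat \<Rightarrow> nat) \<Rightarrow> (nat \<Rightarrow> nat) \<Rightarrow> bool" where
  "sphere_partition E th ph s t \<longleftrightarrow>
     (\<forall>e\<in>{1..E}. 1 \<le> s e \<and> 1 \<le> t e \<and> th (s e - 1) < th (s e) \<and> ph (t e - 1) < ph (t e)) \<and>
     (\<Union>e\<in>{1..E}. element th ph (s e) (t e)) = {0..pi} \<times> {0..2 * pi} \<and>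
     (\<forall>e\<in>{1..E}. \<forall>e'\<in>{1..E}. e \<noteq> e' \<longrightarrow>
        interior (element th ph (s e) (t e)) \<inter> interior (element th ph (s e') (t e')) = {})"


section \<open>The factors of the coefficient formula\<close>

definition azimuth_factor :: "nat \<Rightarrow> (nat \<Rightarrow> real) \<Rightarrow> (nat \<Rightarrow> real) \<Rightarrow> int \<Rightarrow> nat \<Rightarrow> nat \<Rightarrow> complex" where
  "azimuth_factor N xi ph m i t =
     (if m = 0 then
        2 * of_real (lagrange_coeff N xi i 0) * of_real (half_width ph t)
          * exp (- (\<i> * of_int m * of_real (centre ph t)))
      else
        of_real (half_width ph t) * exp (- (\<i> * of_int m * of_real (centre ph t))) *
          (\<Sum>n=0..N. 2 * \<i> powi (- int n) * of_real (lagrange_coeff N xi i n)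
                       * of_real (sph_bessel n (of_int m * half_width ph t))))"

definition Q_int :: "nat \<Rightarrow> nat \<Rightarrow> int \<Rightarrow> real \<Rightarrow> real \<Rightarrow> real" where
  "Q_int n l m lam rho =
     (LBINT x:{-1..1}. poly (legendre n) x * hatP l m (cos (lam * x + rho)) * sin (lam * x + rho))"

definition polar_factor :: "nat \<Rightarrow> (nat \<Rightarrow> real) \<Rightarrow> (nat \<Rightarrow> real) \<Rightarrow> nat \<Rightarrow> int \<Rightarrow> nat \<Rightarrow> nat \<Rightarrow> real" where
  "polar_factor N xi th l m j s =
     half_width th s *
       (\<Sum>n=0..N. lagrange_coeff N xi j n * Q_int n l m (half_width th s) (centre th s))"

text \<open>
  \<open>hatP l m (cos th)\<close> for arbitrary real \<open>th\<close>, with \<open>(1 - cos th ^ 2)\<^bsup>m/2\<^esup>\<close> read as \<open>sin th ^ m\<close>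
  instead of \<open>\<bar>sin th\<bar> ^ m\<close>. This is the real-analytic continuation in \<open>th\<close> of \<open>hatP l m (cos th)\<close>
  from \<open>[0, \<pi>]\<close> to the real line, and the two readings differ only for odd \<open>m\<close> where \<open>sin th < 0\<close>.
\<close>
definition hatP_angle :: "nat \<Rightarrow> int \<Rightarrow> real \<Rightarrow> real" where
  "hatP_angle l m th = (if odd m \<and> sin th < 0 then - hatP l m (cos th) else hatP l m (cos th))"

definition Q_int_angle :: "nat \<Rightarrow> nat \<Rightarrow> int \<Rightarrow> real \<Rightarrow> real \<Rightarrow> real" where
  "Q_int_angle n l m lam rho =
     (LBINT x:{-1..1}. poly (legendre n) x * hatP_angle l m (lam * x + rho) * sin (lam * x + rho))"

definition C_osc :: "nat \<Rightarrow> real \<Rightarrow> real \<Rightarrow> real" where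
  "C_osc n lam rho =
     (if lam = 0 then 2 * (if n = 0 then 1 else 0) * cos rho
      else 2 * sph_bessel n lam *
             (Re (\<i> powi (- int n)) * cos rho + Im (\<i> powi (- int n)) * sin rho))"

definition S_osc :: "nat \<Rightarrow> real \<Rightarrow> real \<Rightarrow> real" where
  "S_osc n lam rho =
     (if lam = 0 then 2 * (if n = 0 then 1 else 0) * sin rho
      else 2 * sph_bessel n lam *
             (Re (\<i> powi (- int n)) * sin rho - Im (\<i> powi (- int n)) * cos rho))"

text \<open>Integer arguments, because \<open>p_freq (-1)\<close> occurs below.\<close>
definition p_freq :: "int \<Rightarrow> real" where "p_freq k = 2 * of_int k + 1"
definition q_freq :: "int \<Rightarrow> real" where "q_freq k = 2 * of_int k"

definition Q_formula :: "nat \<Rightarrow> nat \<Rightarrow> int \<Rightarrow> real \<Rightarrow> real \<Rightarrow> real" where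
  "Q_formula n l m lam rho =
     (if even l then
        (if even m then
           1 / 2 * (\<Sum>k=0..l div 2. trig_coeff l m k *
             (S_osc n (p_freq (int k) * lam) (p_freq (int k) * rho)
               - S_osc n (p_freq (int k - 1) * lam) (p_freq (int k - 1) * rho)))
         else
           1 / 2 * (\<Sum>k=1..l div 2. trig_coeff l m k *
             (C_osc n (p_freq (int k - 1) * lam) (p_freq (int k - 1) * rho)
               - C_osc n (p_freq (int k) * lam) (p_freq (int k) * rho))))
      else
        (if even m then
           1 / 2 * (\<Sum>k=1..(l + 1) div 2. trig_coeff l m k *
             (S_osc n (q_freq (int k) * lam) (q_freq (int k) * rho)
               - S_osc n (q_freq (int k - 1) * lam) (q_freq (int k - 1) * rho)))
         else
           1 / 2 * (\<Sum>k=1..(l + 1) div 2. trig_coeff l m k *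
             (C_osc n (q_freq (int k - 1) * lam) (q_freq (int k - 1) * rho)
               - C_osc n (q_freq (int k) * lam) (q_freq (int k) * rho)))))"

end

theory Submission
  imports Defs
begin

text \<open>
  On each element the integrand is a sum of products of a function of the polar angle and a function
  of the azimuthal angle, so Fubini and affine substitution reduce the coefficient to integrals over
  \<open>[-1, 1]\<close>. Expanding the Lagrange basis in Legendre polynomials, everything rests on
  \<open>\<integral> P\<^sub>n(x) exp(i\<lambda>x) dx = 2 i\<^sup>n j\<^sub>n(\<lambda>)\<close>, which follows by integrating the exponential series against
  \<open>P\<^sub>n\<close> term by term, the moments of \<open>P\<^sub>n\<close> being Beta integrals by Rodrigues' formula.

  For the formula for \<open>Q\<close>, the continued function \<open>hatP_angle l m\<close> is a polynomial in \<open>cos\<close> of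
  parity \<open>l\<close>, or \<open>sin\<close> times one of parity \<open>l - 1\<close>, hence a trigonometric sum on the whole real line,
  with coefficients determined on \<open>[0, \<pi>]\<close> by orthogonality; the product formulas for
  \<open>cos (f y) sin y\<close> and \<open>sin (f y) sin y\<close> then reduce \<open>Q\<close> to the integral above.
\<close>

section \<open>Legendre polynomials and spherical Bessel functions\<close>

lemma degree_legendre [simp]: "degree (legendre n) = n"
proof -
  have "degree ([:-1, 0, 1:] ^ n :: real poly) = 2 * n"
    by (subst degree_power_eq) auto
  then show ?thesis
    by (simp add: legendre_def degree_higher_pderiv)
qed

lemma legendre_0: "legendre 0 = 1"
  by (simp add: legendre_def)

lemma legendre_nonzero [simp]: "legendre n \<noteq> 0"
  by (metis degree_0 degree_legendre legendre_0 one_neq_zero)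

text \<open>The degrees of the Legendre polynomials are 0, 1, 2, ..., so a multiple of
  \<open>legendre (Suc N)\<close> cancels the top coefficient of \<open>p\<close> and leaves degree
  at most \<open>N\<close>.\<close>

lemma legendre_expansion_exists:
  assumes "degree p \<le> N"
  shows "\<exists>v. (\<forall>n>N. v n = 0) \<and> p = (\<Sum>n=0..N. smult (v n) (legendre n))"
  using assms
proof (induction N arbitrary: p)
  case 0
  then obtain c where "p = [:c:]" by (metis degree_0_id le_zero_eq)
  then show ?case
    by (intro exI[of _ "\<lambda>n. if n = 0 then c else 0"]) (simp add: legendre_0)
next
  case (Suc N)
  define c where "c = coeff p (Suc N) / lead_coeff (legendre (Suc N))"
  define q where "q = p - smult c (legendre (Suc N))"
  have "degree q \<le> Suc N"
    unfolding q_def using Suc.prems by (intro degree_diff_le) auto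
  moreover have "coeff q (Suc N) = 0"
    using legendre_nonzero[of "Suc N"] unfolding leading_coeff_0_iff[symmetric]
    by (simp add: q_def c_def)
  ultimately have "degree q \<le> N"
    by (metis coeff_0_degree_minus_1 diff_Suc_1 le_SucE le_degree leading_coeff_0_iff degree_0 zero_le)
  from Suc.IH[OF this] obtain v where v: "\<forall>n>N. v n = 0" "q = (\<Sum>n=0..N. smult (v n) (legendre n))"
    by blast
  have "p = (\<Sum>n=0..Suc N. smult ((v(Suc N := c)) n) (legendre n))"
  proof -
    have "(\<Sum>n=0..N. smult ((v(Suc N := c)) n) (legendre n)) = q"
      unfolding v(2) by (intro sum.cong) auto
    then show ?thesis by (simp add: q_def)
  qed
  then show ?case using v(1) by (intro exI[of _ "v(Suc N := c)"]) auto
qed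

text \<open>Linear independence, again by degrees: the coefficient of order \<open>Suc N\<close>
  sees only the last summand, so the \<open>v n\<close> vanish from the top down.\<close>

lemma legendre_expansion_zero:
  assumes "(\<Sum>n=0..N. smult (v n) (legendre n)) = 0" "n \<le> N"
  shows "v n = 0"
  using assms
proof (induction N arbitrary: n)
  case 0
  then show ?case by (simp add: legendre_0)
next
  case (Suc N)
  have "coeff (\<Sum>n=0..N. smult (v n) (legendre n)) (Suc N) = 0"
    by (intro coeff_eq_0 degree_sum_less) (auto intro: le_less_trans[OF degree_smult_le])
  with arg_cong[OF Suc.prems(1), of "\<lambda>p. coeff p (Suc N)"]
  have "v (Suc N) * lead_coeff (legendre (Suc N)) = 0"
    by simp
  then have v: "v (Suc N) = 0"
    using legendre_nonzero[of "Suc N"] unfolding leading_coeff_0_iff[symmetric] by simp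
  with Suc show ?case by (cases "n = Suc N") auto
qed

text \<open>Existence and uniqueness resolve the definite description in
  \<open>legendre_coeffs\<close>; the default value 0 beyond \<open>N\<close> makes \<open>v\<close>
  unique as a function on all naturals.\<close>

lemma legendre_coeffs_expansion:
  assumes "degree p \<le> N"
  shows "p = (\<Sum>n=0..N. smult (legendre_coeffs N p n) (legendre n))"
proof -
  let ?P = "\<lambda>v. (\<forall>n>N. v n = 0) \<and> p = (\<Sum>n=0..N. smult (v n) (legendre n))"
  obtain v where v: "?P v" using legendre_expansion_exists[OF assms] by blast
  have "w = v" if "?P w" for w
  proof
    fix n
    have "(\<Sum>n=0..N. smult (w n - v n) (legendre n)) = p - p"
      using v that by (simp add: smult_diff_left sum_subtractf)
    then show "w n = v n"
      using legendre_expansion_zero[of "\<lambda>n. w n - v n" N n] v that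
      by (cases "n \<le> N") auto
  qed
  with v have "?P (THE v. ?P v)" by (rule theI)
  then show ?thesis by (simp add: legendre_coeffs_def)
qed

lemma degree_lagrange_basis: 
  assumes "i \<le> N"
  shows "degree (lagrange_basis N xi i) \<le> N"
proof -
  have "degree (lagrange_basis N xi i) \<le> (\<Sum>j\<in>{0..N} - {i}. degree (smult (1 / (xi i - xi j)) [:- xi j, 1:]))"
    unfolding lagrange_basis_def by (rule order.trans[OF degree_prod_sum_le]) (auto simp: o_def)
  also have "\<dots> \<le> (\<Sum>j\<in>{0..N} - {i}. 1)"
    by (intro sum_mono) (simp add: degree_smult_eq)
  also have "\<dots> = N" using assms by simp
  finally show ?thesis .
qed

lemma poly_lagrange_basis:
  assumes "i \<le> N"
  shows "poly (lagrange_basis N xi i) x = (\<Sum>n=0..N. lagrange_coeff N xi i n * poly (legendre n) x)"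
  using arg_cong[OF legendre_coeffs_expansion[OF degree_lagrange_basis[OF assms]], of "\<lambda>p. poly p x"]
  by (simp add: lagrange_coeff_def poly_sum)

section \<open>Integration by parts for polynomials\<close>

lemma poly_integrable: "poly p integrable_on {a..b::real}"
  by (intro integrable_continuous_real continuous_intros)

lemma integral_poly_smult:
  fixes p :: "real poly"
  shows "integral S (poly (smult c p)) = c * integral S (poly p)"
proof -
  have "poly (smult c p) = (\<lambda>x. c * poly p x)" by auto
  then show ?thesis by simp
qed

lemma integral_poly_diff:
  fixes p q :: "real poly"
  shows "integral {a..b} (poly (p - q)) = integral {a..b} (poly p) - integral {a..b} (poly q)"
proof -
  have "poly (p - q) = (\<lambda>x. poly p x - poly q x)" by auto
  then show ?thesis by (simp only: integral_diff[OF poly_integrable poly_integrable])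
qed

lemma has_integral_poly_pderiv:
  fixes p :: "real poly"
  assumes "a \<le> b"
  shows "(poly (pderiv p) has_integral poly p b - poly p a) {a..b}"
  using assms
  by (intro fundamental_theorem_of_calculus)
    (auto simp: has_real_derivative_iff_has_vector_derivative[symmetric] intro!: DERIV_subset[OF poly_DERIV])

lemma integral_poly_by_parts:
  fixes p q :: "real poly"
  assumes "a \<le> b" "poly p a = 0" "poly p b = 0"
  shows "integral {a..b} (poly (pderiv p * q)) = - integral {a..b} (poly (p * pderiv q))"
proof -
  have "integral {a..b} (poly (pderiv p * q + p * pderiv q)) = 0"
    using has_integral_poly_pderiv[OF assms(1), of "p * q"] assms
    by (intro integral_unique) (simp add: pderiv_mult algebra_simps)
  moreover have "integral {a..b} (poly (pderiv p * q + p * pderiv q)) =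
      integral {a..b} (poly (pderiv p * q)) + integral {a..b} (poly (p * pderiv q))"
    unfolding poly_add by (intro integral_add poly_integrable)
  ultimately show ?thesis by simp
qed

text \<open>Every boundary term contains a derivative of \<open>p\<close> of order below
  \<open>n\<close> and so vanishes. The factor \<open>q\<close> stays arbitrary in the induction
  because each step replaces it by \<open>pderiv q\<close>.\<close>

lemma integral_poly_by_parts_iterated:
  fixes p q :: "real poly"
  assumes "a \<le> b" "\<And>k. k < n \<Longrightarrow> poly ((pderiv ^^ k) p) a = 0" "\<And>k. k < n \<Longrightarrow> poly ((pderiv ^^ k) p) b = 0"
  shows "integral {a..b} (poly ((pderiv ^^ n) p * q)) = (-1) ^ n * integral {a..b} (poly (p * (pderiv ^^ n) q))"
  using assms(2,3)
proof (induction n arbitrary: q)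
  case (Suc n)
  have "integral {a..b} (poly ((pderiv ^^ Suc n) p * q)) = - integral {a..b} (poly ((pderiv ^^ n) p * pderiv q))"
    using Suc.prems assms(1) by (simp add: integral_poly_by_parts)
  also have "\<dots> = - ((-1) ^ n * integral {a..b} (poly (p * (pderiv ^^ n) (pderiv q))))"
    using Suc.prems by (subst Suc.IH) auto
  finally show ?case by (simp only: funpow_Suc_right o_apply power_Suc mult_minus1 mult_minus_left)
qed simp

text \<open>By the product rule, one differentiation costs at most one power of a factor.\<close>

lemma power_dvd_pderiv:
  fixes p q :: "real poly"
  assumes "q ^ Suc n dvd p"
  shows "q ^ n dvd pderiv p"
proof -
  from assms obtain r where "p = q ^ Suc n * r" by blast
  then have "pderiv p = q ^ n * (q * pderiv r + smult (of_nat (Suc n)) (pderiv q * r))"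
    by (simp add: pderiv_mult pderiv_power_Suc algebra_simps del: power_Suc)
       (simp add: algebra_simps)
  then show ?thesis by simp
qed

lemma power_dvd_higher_pderiv:
  fixes p q :: "real poly"
  assumes "q ^ (k + n) dvd p"
  shows "q ^ n dvd (pderiv ^^ k) p"
  using assms
proof (induction k arbitrary: n)
  case (Suc k)
  then have "q ^ (k + Suc n) dvd p" by simp
  from Suc.IH[OF this] show ?case by (simp add: power_dvd_pderiv del: power_Suc)
qed simp

text \<open>A root of \<open>q\<close> has multiplicity at least \<open>n\<close> in
  \<open>q ^ n\<close> and survives fewer than \<open>n\<close> differentiations. This supplies the
  vanishing boundary terms for Rodrigues' formula.\<close>

lemma poly_higher_pderiv_root:
  fixes p q :: "real poly"
  assumes "k < n" "poly q a = 0"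
  shows "poly ((pderiv ^^ k) (q ^ n)) a = 0"
proof -
  have "q ^ (k + (n - k)) dvd q ^ n" using assms by simp
  then have "q ^ (n - k) dvd (pderiv ^^ k) (q ^ n)" by (rule power_dvd_higher_pderiv)
  moreover have "q dvd q ^ (n - k)" using assms by (intro dvd_power) auto
  ultimately show ?thesis using assms(2) by (meson dvd_trans poly_eq_0_iff_dvd)
qed

text \<open>The substitution t = x^2 would identify this as the Beta value B(k + 1/2, n + 1). The
  proof instead derives a recursion in \<open>n\<close> at fixed \<open>k\<close> from two linear
  relations between neighbouring integrals.\<close>

lemma integral_beta_poly:
  "integral {-1..1} (poly ([:1, 0, -1:] ^ n * monom (1::real) (2 * k))) =
     Gamma (k + 1/2) * fact n / Gamma (real n + real k + 3/2)"
proof (induction n arbitrary: k)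
  case 0
  have "(poly (monom 1 (2*k)) has_integral poly (monom (1 / (2*k+1)) (2*k+1)) 1 - poly (monom (1 / (2*k+1)) (2*k+1)) (-1)) {-1..1::real}"
    using has_integral_poly_pderiv[of "-1" 1 "monom (1 / (2*k+1)) (2*k+1)"] by (simp add: pderiv_monom add.commute)
  then have "integral {-1..1} (poly (monom (1::real) (2*k))) = 1 / (k + 1/2)"
    by (intro integral_unique) (simp add: poly_monom field_simps)
  moreover have "Gamma (k + 1/2 + 1) = (k + 1/2) * Gamma (k + 1/2 :: real)"
    by (rule Gamma_plus1) (auto simp: nonpos_Ints_def)
  moreover have "Gamma (k + 1/2 :: real) \<noteq> 0" by (intro Gamma_real_pos less_imp_neq[symmetric]) auto
  ultimately show ?case by (simp add: add_ac)
next
  case (Suc n)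
  define w :: "real poly" where "w = [:1, 0, -1:]"
  define M where "M n k = integral {-1..1} (poly (w ^ n * monom (1::real) (2 * k)))" for n k
  have rec1: "M (Suc n) k = M n k - M n (Suc k)"
  proof -
    have "w ^ Suc n * monom 1 (2 * k) = w ^ n * monom 1 (2 * k) - w ^ n * monom 1 (2 * Suc k)"
      by (subst poly_eq_poly_eq_iff[symmetric]) (simp add: fun_eq_iff w_def poly_monom algebra_simps power2_eq_square)
    then show ?thesis
      unfolding M_def by (simp only: integral_poly_diff)
  qed
  \<comment> \<open>The derivative of \<open>w ^ Suc n\<close> times x^(2k+1) integrates to zero,
    because \<open>w\<close> vanishes at both endpoints.\<close>
  have rec2: "(2 * k + 1) * M (Suc n) k = 2 * (n + 1) * M n (Suc k)"
  proof -
    have *: "pderiv (w ^ Suc n * monom 1 (Suc (2 * k))) =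
        smult (2 * k + 1) (w ^ Suc n * monom 1 (2 * k)) - smult (2 * (n + 1)) (w ^ n * monom 1 (2 * Suc k))"
    proof -
      have "pderiv w = - smult 2 (monom 1 1)"
        by (simp add: w_def pderiv_pCons monom_altdef)
      then show ?thesis
        unfolding pderiv_mult pderiv_power_Suc pderiv_monom
        by (subst poly_eq_poly_eq_iff[symmetric]) (simp add: fun_eq_iff poly_monom algebra_simps)
    qed
    have "integral {-1..1} (poly (pderiv (w ^ Suc n * monom 1 (Suc (2 * k))))) = 0"
      using has_integral_poly_pderiv[of "-1" 1 "w ^ Suc n * monom 1 (Suc (2 * k))"]
      by (intro integral_unique) (simp add: w_def)
    moreover have "integral {-1..1} (poly (pderiv (w ^ Suc n * monom 1 (Suc (2 * k))))) =
       (2 * k + 1) * M (Suc n) k - 2 * (n + 1) * M n (Suc k)"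
      unfolding * integral_poly_diff integral_poly_smult M_def ..
    ultimately show ?thesis by simp
  qed
  \<comment> \<open>Eliminating \<open>M n (Suc k)\<close> from the two relations leaves
    \<open>k\<close> unchanged.\<close>
  have M_Suc: "M (Suc n) k = (n + 1) * M n k / (real n + real k + 3/2)"
  proof -
    from rec1 have "M n (Suc k) = M n k - M (Suc n) k" by simp
    from rec2[unfolded this] show ?thesis by (simp add: field_simps)
  qed
  have "Gamma (real n + real k + 3/2 + 1) = (real n + real k + 3/2) * Gamma (real n + real k + 3/2 :: real)"
    by (rule Gamma_plus1) (auto simp: nonpos_Ints_def)
  moreover have "M n k = Gamma (k + 1/2) * fact n / Gamma (real n + real k + 3/2)"
    unfolding M_def w_def Suc.IH by simp
  ultimately have "M (Suc n) k = Gamma (k + 1/2) * fact (Suc n) / Gamma (real n + real k + 3/2 + 1)"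
    unfolding M_Suc by (simp add: mult_ac)
  moreover have "real n + real k + 3/2 + 1 = real (Suc n) + real k + 3/2" by simp
  ultimately show ?case unfolding M_def w_def by (simp only:)
qed

section \<open>Moments of the Legendre polynomials\<close>

lemma integral_odd_eq_0:
  fixes f :: "real \<Rightarrow> real"
  assumes "\<And>x. f (- x) = - f x"
  shows "integral {-a..a} f = 0"
proof -
  have "integral {-a..a} (\<lambda>x. f (- x)) = integral {-a..a} f"
    using Henstock_Kurzweil_Integration.integral_reflect_real[of a "-a" f] by (simp only: minus_minus)
  then show ?thesis unfolding assms by simp
qed

lemma higher_pderiv_monom_real:
  "(pderiv ^^ n) (monom (1::real) (n + d)) = monom (fact (n + d) / fact d) d"
proof (induction n arbitrary: d)
  case (Suc n)
  have "(pderiv ^^ Suc n) (monom (1::real) (Suc n + d)) = pderiv ((pderiv ^^ n) (monom 1 (n + Suc d)))"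
    by simp
  also have "\<dots> = monom (fact (Suc n + d) / fact d) d"
    unfolding Suc.IH by (simp add: pderiv_monom divide_simps)
  finally show ?case .
qed (simp add: monom_altdef)

lemma higher_pderiv_eq_0:
  fixes p :: "real poly"
  assumes "degree p < n"
  shows "(pderiv ^^ n) p = 0"
  using assms by (intro poly_eqI) (simp add: coeff_higher_pderiv coeff_eq_0)

text \<open>Integrate Rodrigues' formula by parts \<open>n\<close> times; the boundary terms vanish.\<close>

lemma integral_legendre_mult:
  "integral {-1..1} (poly (legendre n * q)) =
     1 / (2 ^ n * fact n) * integral {-1..1} (poly ([:1, 0, -1:] ^ n * (pderiv ^^ n) q))"
proof -
  \<comment> \<open>The sign from turning x^2 - 1 into 1 - x^2 cancels the sign from the
    \<open>n\<close> integrations by parts.\<close>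
  have neg: "[:-1, 0, 1:] ^ n = smult ((-1) ^ n) ([:1, 0, -1:] ^ n :: real poly)"
    by (simp flip: smult_power)
  have "integral {-1..1} (poly ((pderiv ^^ n) ([:-1, 0, 1:] ^ n) * q)) =
      (-1) ^ n * integral {-1..1} (poly ([:-1, 0, 1:] ^ n * (pderiv ^^ n) q))"
    by (intro integral_poly_by_parts_iterated poly_higher_pderiv_root) auto
  also have "\<dots> = integral {-1..1} (poly ([:1, 0, -1:] ^ n * (pderiv ^^ n) q))"
    unfolding neg mult_smult_left integral_poly_smult by (simp flip: power_mult_distrib mult.assoc)
  finally show ?thesis by (simp add: legendre_def integral_poly_smult)
qed

lemma poly_legendre_power: "(\<lambda>x. poly (legendre n) x * x ^ m) = poly (legendre n * monom 1 m)"
  by (simp add: fun_eq_iff poly_monom)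

text \<open>For \<open>m < n\<close> the \<open>n\<close>-th derivative of x^m is zero; for odd
  \<open>n + m\<close> the integrand left after integration by parts is odd.\<close>

lemma legendre_moment_eq_0:
  assumes "m < n \<or> odd (n + m)"
  shows "integral {-1..1} (\<lambda>x. poly (legendre n) x * x ^ m) = 0"
proof -
  have "integral {-1..1} (poly ([:1, 0, -1:] ^ n * (pderiv ^^ n) (monom (1::real) m))) = 0"
  proof (cases "m < n")
    case True
    then have "(pderiv ^^ n) (monom (1::real) m) = 0"
      by (intro higher_pderiv_eq_0) (simp add: degree_monom_eq)
    moreover have "poly (0::real poly) = (\<lambda>_. 0)" by auto
    ultimately show ?thesis by simp
  next
    case False
    then obtain d where d: "m = n + d" using le_Suc_ex linorder_not_less by blast
    with False assms have "odd d" by auto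
    then show ?thesis
      unfolding d higher_pderiv_monom_real by (intro integral_odd_eq_0) (simp add: poly_monom)
  qed
  then show ?thesis
    by (simp add: poly_legendre_power integral_legendre_mult)
qed

text \<open>The closed form makes the factors \<open>fact (2 * k)\<close> cancel in
  \<open>legendre_moment\<close>.\<close>

lemma Gamma_nat_plus_half: "Gamma (real k + 1/2) = fact (2 * k) * sqrt pi / (4 ^ k * fact k)"
proof (induction k)
  case (Suc k)
  have "Gamma (real (Suc k) + 1/2) = (k + 1/2) * Gamma (real k + 1/2)"
    using Gamma_plus1[of "real k + 1/2"] by (auto simp: nonpos_Ints_def add_ac)
  also have "\<dots> = (k + 1/2) * (fact (2 * k) * sqrt pi / (4 ^ k * fact k))"
    unfolding Suc.IH ..
  also have "\<dots> = (2 * k + 2) * (2 * k + 1) * fact (2 * k) * sqrt pi / (4 ^ Suc k * fact (Suc k))"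
    by (simp add: divide_simps) (simp add: algebra_simps)
  also have "(2 * k + 2) * (2 * k + 1) * fact (2 * k) = (fact (2 * Suc k) :: real)"
    by (simp add: algebra_simps)
  finally show ?case .
qed (simp add: Gamma_one_half_real)

text \<open>The orders \<open>n + 2 * k\<close> are those left open by
  \<open>legendre_moment_eq_0\<close>. After division by \<open>fact (n + 2 * k)\<close> the value
  has the shape of a coefficient of \<open>sph_bessel\<close>.\<close>

lemma legendre_moment:
  "integral {-1..1} (\<lambda>x. poly (legendre n) x * x ^ (n + 2 * k)) =
     fact (n + 2 * k) * sqrt pi / (2 ^ (n + 2 * k) * fact k * Gamma (real k + real n + 3/2))"
proof -
  have *: "[:1, 0, -1:] ^ n * (pderiv ^^ n) (monom (1::real) (n + 2 * k)) =
     smult (fact (n + 2 * k) / fact (2 * k)) ([:1, 0, -1:] ^ n * monom 1 (2 * k))"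
    by (simp add: higher_pderiv_monom_real smult_monom flip: mult_smult_right)
  have "integral {-1..1} (\<lambda>x. poly (legendre n) x * x ^ (n + 2 * k)) =
     1 / (2 ^ n * fact n) * (fact (n + 2 * k) / fact (2 * k) *
       (Gamma (k + 1/2) * fact n / Gamma (n + k + 3/2)))"
    unfolding poly_legendre_power integral_legendre_mult * integral_poly_smult integral_beta_poly by simp
  also have "\<dots> = fact (n + 2 * k) * sqrt pi / (2 ^ (n + 2 * k) * fact k * Gamma (real k + real n + 3/2))"
    unfolding Gamma_nat_plus_half by (simp add: power_add power_mult add_ac)
  finally show ?thesis .
qed

section \<open>Fourier integrals of the Legendre polynomials\<close>

lemma has_integral_legendre_exp:
  "((\<lambda>x. of_real (poly (legendre n) x) * exp (\<i> * of_real (lam * x))) has_integral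
     2 * \<i> ^ n * of_real (sph_bessel n lam)) {-1..1}"
proof -
  define P where "P = poly (legendre n)"
  \<comment> \<open>\<open>f m\<close> is the \<open>m\<close>-th term of the exponential series
    times \<open>P\<close>, \<open>c m\<close> its integral, and \<open>d k\<close> the
    \<open>k\<close>-th term of the series in \<open>sph_bessel\<close>.\<close>
  define f :: "nat \<Rightarrow> real \<Rightarrow> complex" where
    "f m x = of_real (P x) * ((\<i> * of_real (lam * x)) ^ m /\<^sub>R fact m)" for m x
  define mom where "mom m = integral {-1..1} (\<lambda>x. P x * x ^ m)" for m
  define c :: "nat \<Rightarrow> complex" where "c m = (\<i> * of_real lam) ^ m /\<^sub>R fact m * of_real (mom m)" for m
  define d where "d k = (-1) ^ k / (fact k * Gamma (real k + real n + 3/2)) * (lam / 2) ^ (n + 2 * k)" for k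
  have P_cont: "continuous_on {-1..1} P" unfolding P_def by (intro continuous_intros)
  then obtain B where B: "B \<ge> 0" "\<And>x. x \<in> {-1..1} \<Longrightarrow> norm (P x) \<le> B"
    using continuous_on_compact_bound[of "{-1..1}" P] by auto
  have f_has: "(f m has_integral c m) {-1..1}" for m
  proof -
    have "((\<lambda>x. P x * x ^ m) has_integral mom m) {-1..1}"
      unfolding mom_def
      by (intro integrable_integral integrable_continuous_real continuous_intros P_cont)
    from has_integral_mult_right[OF has_integral_linear[OF this bounded_linear_of_real],
        of "(\<i> * of_real lam) ^ m /\<^sub>R fact m"]
    show ?thesis
      unfolding f_def c_def o_def by (simp add: power_mult_distrib mult_ac scaleR_conv_of_real)
  qed
  \<comment> \<open>On [-1, 1] the exponential series of \<bar>\<open>lam\<close>\<bar> is a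
    majorant up to the factor \<open>B\<close>; uniform convergence then permits integration term by
    term.\<close>
  have u: "uniform_limit {-1..1} (\<lambda>M x. \<Sum>m<M. f m x) (\<lambda>x. \<Sum>m. f m x) sequentially"
  proof (rule Weierstrass_m_test)
    fix m and x :: real assume x: "x \<in> {-1..1}"
    then have "\<bar>x\<bar> ^ m \<le> 1" by (intro power_le_one) auto
    then have "\<bar>lam * x\<bar> ^ m \<le> \<bar>lam\<bar> ^ m"
      by (simp add: power_mult_distrib abs_mult mult_left_le)
    then show "norm (f m x) \<le> B * (inverse (fact m) * \<bar>lam\<bar> ^ m)"
      unfolding f_def using B x
      by (auto simp: norm_mult norm_power simp flip: of_real_mult intro!: mult_mono)
  qed (intro summable_mult summable_exp)
  have f_sum: "(\<Sum>m. f m x) = of_real (P x) * exp (\<i> * of_real (lam * x))" for x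
    unfolding f_def by (intro sums_unique[symmetric] sums_mult exp_converges)
  have f_cont: "continuous_on {-1..1} (\<lambda>x. \<Sum>m<M. f m x)" for M
    unfolding f_def by (intro continuous_intros P_cont)
  obtain I J where I: "\<And>M. ((\<lambda>x. \<Sum>m<M. f m x) has_integral I M) {-1..1}"
    and J: "((\<lambda>x. of_real (P x) * exp (\<i> * of_real (lam * x))) has_integral J) {-1..1}"
    and lim: "I \<longlonglongrightarrow> J"
    using uniform_limit_integral[OF u[unfolded f_sum] f_cont sequentially_bot] by blast
  have "I = (\<lambda>M. \<Sum>m<M. c m)"
  proof
    show "I M = (\<Sum>m<M. c m)" for M
      using I by (rule has_integral_unique) (intro has_integral_sum f_has, simp)
  qed
  with lim have "c sums J" by (simp add: sums_def)
  \<comment> \<open>Only the indices \<open>n + 2 * k\<close> contribute, so the series can be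
    reindexed by \<open>k\<close>.\<close>
  moreover have "c m = 0" if "m \<notin> range (\<lambda>k. n + 2 * k)" for m
  proof -
    have "m < n \<or> odd (n + m)"
    proof (rule ccontr)
      assume "\<not> (m < n \<or> odd (n + m))"
      then have "m = n + 2 * ((m - n) div 2)" by auto
      with that show False by blast
    qed
    then show ?thesis by (simp add: c_def mom_def P_def legendre_moment_eq_0)
  qed
  moreover have "c (n + 2 * k) = \<i> ^ n * of_real (sqrt pi * d k)" for k
  proof -
    have i_power: "\<i> ^ (n + 2 * k) = \<i> ^ n * (-1) ^ k"
      by (simp add: power_add power_mult)
    have "c (n + 2 * k) = \<i> ^ n * of_real ((-1) ^ k * lam ^ (n + 2 * k) / fact (n + 2 * k) * mom (n + 2 * k))"
      unfolding c_def power_mult_distrib i_power by (simp add: scaleR_conv_of_real divide_inverse)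
    also have "(-1) ^ k * lam ^ (n + 2 * k) / fact (n + 2 * k) * mom (n + 2 * k) = sqrt pi * d k"
      unfolding mom_def P_def legendre_moment d_def by (simp add: power_divide mult_ac)
    finally show ?thesis .
  qed
  ultimately have "(\<lambda>k. \<i> ^ n * of_real (sqrt pi * d k)) sums J"
    using sums_mono_reindex[of "\<lambda>k. n + 2 * k" c J] by (simp add: strict_mono_def)
  from sums_mult[OF this, of "inverse (\<i> ^ n)"]
  have J': "(\<lambda>k. complex_of_real (sqrt pi * d k)) sums (inverse (\<i> ^ n) * J)"
    by (simp add: mult.assoc[symmetric])
  \<comment> \<open>Summability of the real series \<open>d\<close> has to be established before
    \<open>suminf d\<close> carries information; it is read off from the real part of the convergent
    complex series.\<close>
  from sums_Re[OF this] have "(\<lambda>k. sqrt pi * d k) sums Re (inverse (\<i> ^ n) * J)"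
    by simp
  from sums_mult[OF this, of "1 / sqrt pi"] have "d sums (Re (inverse (\<i> ^ n) * J) / sqrt pi)"
    by simp
  then have d: "d sums suminf d" by (simp add: sums_iff)
  from sums_of_real[OF sums_mult[OF this, of "sqrt pi"], where 'a = complex]
  have "inverse (\<i> ^ n) * J = of_real (sqrt pi * suminf d)"
    by (rule sums_unique2[OF J'])
  then have "J = \<i> ^ n * of_real (sqrt pi * suminf d)"
    by (simp add: field_simps)
  also have "\<dots> = 2 * \<i> ^ n * of_real (sph_bessel n lam)"
    by (simp add: sph_bessel_def d_def[abs_def])
  finally show ?thesis using J by (simp add: P_def)
qed

text \<open>Complex conjugate of the previous integral: since \<open>\<i>\<close> has modulus one,
  its inverse powers are conjugates of its powers.\<close>

lemma has_integral_legendre_exp_neg: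
  "((\<lambda>x. of_real (poly (legendre n) x) * exp (- (\<i> * of_real (lam * x)))) has_integral
     2 * \<i> powi (- int n) * of_real (sph_bessel n lam)) {-1..1}"
proof -
  have "\<i> powi (- int n) = cnj (\<i> ^ n)"
    by (simp add: power_int_minus flip: power_inverse)
  then show ?thesis
    using has_integral_linear[OF has_integral_legendre_exp bounded_linear_cnj, of n lam]
    by (simp add: o_def exp_cnj)
qed

text \<open>At 0 only a term with exponent \<open>n + 2 * k = 0\<close> survives. Hence the separate
  cases for argument 0 in the coefficient formulas agree with the general ones.\<close>

lemma sph_bessel_0_right: "sph_bessel n 0 = (if n = 0 then 1 else 0)"
proof -
  have "(\<lambda>k. (-1) ^ k / (fact k * Gamma (real k + real n + 3 / 2)) * (0 / 2) ^ (n + 2 * k) :: real) =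
     (\<lambda>k. if k = 0 then (if n = 0 then 1 / Gamma (3/2) else 0) else 0)"
    by (auto simp: fun_eq_iff)
  moreover have "(\<Sum>k. if k = (0::nat) then c else 0) = c" for c :: real
    using sums_single[of 0 "\<lambda>_. c", THEN sums_unique] by simp
  ultimately have "sph_bessel n 0 = sqrt pi / 2 * (if n = 0 then 1 / Gamma (3/2) else 0)"
    unfolding sph_bessel_def by simp
  also have "Gamma (3/2) = sqrt pi / 2"
    using Gamma_nat_plus_half[of 1] by simp
  finally show ?thesis by (cases "n = 0") simp_all
qed

text \<open>Both integrals come from that of \<open>poly (legendre n) x\<close> times
  exp(-i(\<open>lam\<close> x + \<open>rho\<close>)): the real part gives the cosine, the negated
  imaginary part the sine.\<close>

lemma has_integral_legendre_cos:
  "((\<lambda>x. poly (legendre n) x * cos (lam * x + rho)) has_integral C_osc n lam rho) {-1..1}"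
  and has_integral_legendre_sin:
  "((\<lambda>x. poly (legendre n) x * sin (lam * x + rho)) has_integral S_osc n lam rho) {-1..1}"
proof -
  define z where "z = \<i> powi (- int n)"
  have z0: "lam = 0 \<Longrightarrow> z * of_real (sph_bessel n lam) = of_real (if n = 0 then 1 else 0)"
    by (simp add: sph_bessel_0_right z_def)
  have *: "((\<lambda>x. exp (- (\<i> * of_real rho)) * (of_real (poly (legendre n) x) * exp (- (\<i> * of_real (lam * x)))))
     has_integral exp (- (\<i> * of_real rho)) * (2 * z * of_real (sph_bessel n lam))) {-1..1}"
    unfolding z_def by (intro has_integral_mult_right has_integral_legendre_exp_neg)
  have eq: "exp (- (\<i> * of_real rho)) * (of_real (poly (legendre n) x) * exp (- (\<i> * of_real (lam * x)))) =
      of_real (poly (legendre n) x) * cnj (cis (lam * x + rho))" for x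
    by (simp add: cis_conv_exp exp_cnj exp_add[symmetric] algebra_simps)
  have val: "exp (- (\<i> * of_real rho)) * (2 * z * of_real (sph_bessel n lam)) =
      Complex (C_osc n lam rho) (- S_osc n lam rho)"
  proof (cases "lam = 0")
    case True
    with z0 show ?thesis
      by (simp add: C_osc_def S_osc_def complex_eq_iff exp_eq_polar cis_conv_exp[symmetric] mult.assoc)
  next
    case False
    then show ?thesis
      by (simp add: C_osc_def S_osc_def complex_eq_iff exp_eq_polar z_def[symmetric] algebra_simps)
  qed
  note ** = *[unfolded eq val]
  show "((\<lambda>x. poly (legendre n) x * cos (lam * x + rho)) has_integral C_osc n lam rho) {-1..1}"
    using has_integral_Re[OF **] by simp
  show "((\<lambda>x. poly (legendre n) x * sin (lam * x + rho)) has_integral S_osc n lam rho) {-1..1}"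
    using has_integral_neg[OF has_integral_Im[OF **]] by simp
qed

section \<open>Trigonometric expansion of the Legendre functions\<close>

definition fun_span :: "nat set \<Rightarrow> (nat \<Rightarrow> real \<Rightarrow> real) \<Rightarrow> (real \<Rightarrow> real) set" where
  "fun_span K b = {f. \<exists>a. \<forall>x. f x = (\<Sum>k\<in>K. a k * b k x)}"

lemma fun_span_0: "(\<lambda>x. 0) \<in> fun_span K b"
  unfolding fun_span_def by (auto intro!: exI[of _ "\<lambda>_. 0"])

lemma fun_span_scale: "f \<in> fun_span K b \<Longrightarrow> (\<lambda>x. c * f x) \<in> fun_span K b"
proof -
  assume "f \<in> fun_span K b"
  then obtain a where "\<forall>x. f x = (\<Sum>k\<in>K. a k * b k x)" by (auto simp: fun_span_def)
  then show ?thesis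
    unfolding fun_span_def
    by (auto intro!: exI[of _ "\<lambda>k. c * a k"] simp: sum_distrib_left mult.assoc)
qed

lemma fun_span_add:
  assumes "f \<in> fun_span K b" "g \<in> fun_span K b"
  shows "(\<lambda>x. f x + g x) \<in> fun_span K b"
proof -
  from assms obtain a a' where "\<forall>x. f x = (\<Sum>k\<in>K. a k * b k x)" "\<forall>x. g x = (\<Sum>k\<in>K. a' k * b k x)"
    by (auto simp: fun_span_def)
  then show ?thesis
    unfolding fun_span_def
    by (auto intro!: exI[of _ "\<lambda>k. a k + a' k"] simp: distrib_right sum.distrib)
qed

lemma fun_span_sum:
  "(\<And>i. i \<in> I \<Longrightarrow> f i \<in> fun_span K b) \<Longrightarrow> (\<lambda>x. \<Sum>i\<in>I. f i x) \<in> fun_span K b"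
  by (induction I rule: infinite_finite_induct) (auto intro: fun_span_0 fun_span_add)

lemma fun_span_base: "finite K \<Longrightarrow> k \<in> K \<Longrightarrow> b k \<in> fun_span K b"
  unfolding fun_span_def by (auto intro!: exI[of _ "\<lambda>i. of_bool (i = k)"])

text \<open>Multiplication by \<open>g\<close> is linear, so it is enough to control it on the
  spanning functions.\<close>

lemma fun_span_mult:
  assumes "f \<in> fun_span K b" "\<And>k. k \<in> K \<Longrightarrow> (\<lambda>x. g x * b k x) \<in> fun_span K' b'"
  shows "(\<lambda>x. g x * f x) \<in> fun_span K' b'"
proof -
  from assms(1) obtain a where a: "\<forall>x. f x = (\<Sum>k\<in>K. a k * b k x)" by (auto simp: fun_span_def)
  have "(\<lambda>x. \<Sum>k\<in>K. a k * (g x * b k x)) \<in> fun_span K' b'"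
    by (intro fun_span_sum fun_span_scale assms(2))
  with a show ?thesis by (simp add: sum_distrib_left mult_ac)
qed

lemma fun_span_trans:
  assumes "f \<in> fun_span K b" "\<And>k. k \<in> K \<Longrightarrow> b k \<in> fun_span K' b'"
  shows "f \<in> fun_span K' b'"
  using fun_span_mult[of f K b "\<lambda>_. 1"] assms by simp

text \<open>The frequencies that occur in a trigonometric polynomial of degree \<open>l\<close> and
  parity \<open>l\<close>.\<close>

definition same_parity :: "nat \<Rightarrow> nat set" where
  "same_parity l = {k. k \<le> l \<and> even (k + l)}"

lemma finite_same_parity [simp]: "finite (same_parity l)"
  by (simp add: same_parity_def)

lemma same_parity_mono: "l \<le> l' \<Longrightarrow> even (l + l') \<Longrightarrow> same_parity l \<subseteq> same_parity l'"
  by (auto simp: same_parity_def)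

text \<open>By the product-to-sum formulas, multiplication by cos moves each frequency up and down
  by one, which flips the parity and raises the bound by one.\<close>

lemma cos_mult_fun_span:
  assumes t: "t = cos \<or> t = sin" and i: "i \<in> same_parity l"
  shows "(\<lambda>x. cos x * t (real i * x)) \<in> fun_span (same_parity (Suc l)) (\<lambda>k x. t (real k * x))"
proof (cases i)
  \<comment> \<open>Frequency 0 has no natural predecessor: the product is cos x for cosines and 0
    for sines.\<close>
  case 0
  have "(\<lambda>x. cos (real 1 * x)) \<in> fun_span (same_parity (Suc l)) (\<lambda>k x. cos (real k * x))"
    by (rule fun_span_base) (use i 0 in \<open>auto simp: same_parity_def\<close>)
  with 0 t show ?thesis by (auto intro: fun_span_0)
next
  case (Suc j)
  have "(\<lambda>x. 1/2 * (t (real (i + 1) * x) + t (real j * x))) \<in> fun_span (same_parity (Suc l)) (\<lambda>k x. t (real k * x))"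
    by (intro fun_span_scale fun_span_add
          fun_span_base[where b = "\<lambda>k x. t (real k * x)" and k = "i + 1"]
          fun_span_base[where b = "\<lambda>k x. t (real k * x)" and k = j])
      (use i Suc in \<open>auto simp: same_parity_def\<close>)
  moreover have "1/2 * (t (real (i + 1) * x) + t (real j * x)) = cos x * t (real i * x)" for x
  proof -
    have "real (i + 1) * x = real i * x + x" "real j * x = real i * x - x"
      by (simp_all add: Suc algebra_simps)
    then show ?thesis using t by (auto simp: cos_add cos_diff sin_add sin_diff)
  qed
  ultimately show ?thesis by simp
qed

lemma cos_power_mult_fun_span:
  assumes t: "t = cos \<or> t = sin" and f: "f \<in> fun_span (same_parity l) (\<lambda>k x. t (real k * x))"
  shows "(\<lambda>x. cos x ^ j * f x) \<in> fun_span (same_parity (l + j)) (\<lambda>k x. t (real k * x))"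
proof (induction j)
  case (Suc j)
  then have "(\<lambda>x. cos x * (cos x ^ j * f x)) \<in> fun_span (same_parity (Suc (l + j))) (\<lambda>k x. t (real k * x))"
    by (rule fun_span_mult) (rule cos_mult_fun_span[OF t])
  then show ?case by (simp add: mult.assoc)
qed (use f in simp)

section \<open>Parity of polynomials\<close>

definition has_parity :: "nat \<Rightarrow> real poly \<Rightarrow> bool" where
  "has_parity d q \<longleftrightarrow> (\<forall>i. odd (i + d) \<longrightarrow> coeff q i = 0)"

lemma has_parity_mult:
  assumes "has_parity d p" "has_parity e q"
  shows "has_parity (d + e) (p * q)"
  unfolding has_parity_def
proof (intro allI impI)
  fix n assume n: "odd (n + (d + e))"
  have "coeff p i * coeff q (n - i) = 0" if "i \<le> n" for i
  proof -
    have "odd (i + d) \<or> odd (n - i + e)" using n that by auto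
    then have "coeff p i = 0 \<or> coeff q (n - i) = 0"
      using assms unfolding has_parity_def by blast
    then show ?thesis by auto
  qed
  then show "coeff (p * q) n = 0" unfolding coeff_mult by (intro sum.neutral) auto
qed

lemma has_parity_power: "has_parity d p \<Longrightarrow> has_parity (n * d) (p ^ n)"
proof (induction n)
  case 0
  show ?case by (simp add: has_parity_def odd_pos)
next
  case (Suc n)
  then show ?case using has_parity_mult[of d p "n * d" "p ^ n"] by simp
qed

lemma has_parity_quadratic: "has_parity 0 [:a, 0, b:]"
proof -
  have "coeff [:a, 0, b:] i = 0" if "odd i" for i
    using that by (cases i; cases "i - 1"; cases "i - 2") auto
  then show ?thesis by (simp add: has_parity_def)
qed

lemma has_parity_higher_pderiv: "has_parity (d + n) p \<Longrightarrow> has_parity d ((pderiv ^^ n) p)"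
  unfolding has_parity_def
proof (intro allI impI)
  fix i assume p: "\<forall>i. odd (i + (d + n)) \<longrightarrow> coeff p i = 0" and "odd (i + d)"
  then have "odd (i + n + (d + n))" by presburger
  with p have "coeff p (i + n) = 0" by blast
  then show "coeff ((pderiv ^^ n) p) i = 0" by (simp add: coeff_higher_pderiv)
qed

lemma has_parity_legendre: "has_parity n (legendre n)"
proof -
  have "has_parity 0 ([:-1, 0, 1:] ^ n)"
    using has_parity_power[OF has_parity_quadratic, of n "-1" 1] by simp
  \<comment> \<open>Only the parity of the index matters, so 0 may be replaced by
    \<open>n + n\<close>, which \<open>n\<close> differentiations lower to \<open>n\<close>.\<close>
  then have "has_parity (n + n) ([:-1, 0, 1:] ^ n)" by (simp add: has_parity_def)
  from has_parity_higher_pderiv[OF this] show ?thesis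
    by (simp add: has_parity_def legendre_def)
qed

text \<open>A power \<open>j\<close> of cos with nonzero coefficient satisfies
  \<open>j \<le> d\<close> and has the parity of \<open>d\<close>; its frequencies therefore lie in
  \<open>same_parity (l + d)\<close>.\<close>

lemma poly_cos_mult_fun_span:
  assumes t: "t = cos \<or> t = sin" and f: "f \<in> fun_span (same_parity l) (\<lambda>k x. t (real k * x))"
    and q: "degree q \<le> d" "has_parity d q"
  shows "(\<lambda>x. poly q (cos x) * f x) \<in> fun_span (same_parity (l + d)) (\<lambda>k x. t (real k * x))"
proof -
  have "(\<lambda>x. coeff q j * (cos x ^ j * f x)) \<in> fun_span (same_parity (l + d)) (\<lambda>k x. t (real k * x))"
    if j: "j \<le> degree q" for j
  proof (cases "even (j + d)")
    case True
    have "(\<lambda>x. cos x ^ j * f x) \<in> fun_span (same_parity (l + j)) (\<lambda>k x. t (real k * x))"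
      by (rule cos_power_mult_fun_span[OF t f])
    then have "(\<lambda>x. cos x ^ j * f x) \<in> fun_span (same_parity (l + d)) (\<lambda>k x. t (real k * x))"
    proof (rule fun_span_trans)
      fix k assume "k \<in> same_parity (l + j)"
      moreover have "same_parity (l + j) \<subseteq> same_parity (l + d)"
        using True j q by (intro same_parity_mono) auto
      ultimately show "(\<lambda>x. t (real k * x)) \<in> fun_span (same_parity (l + d)) (\<lambda>k x. t (real k * x))"
        by (intro fun_span_base[where b = "\<lambda>k x. t (real k * x)"]) auto
    qed
    then show ?thesis by (rule fun_span_scale)
  next
    case False
    with q show ?thesis by (simp add: has_parity_def fun_span_0)
  qed
  then have "(\<lambda>x. \<Sum>j\<le>degree q. coeff q j * (cos x ^ j * f x)) \<in> fun_span (same_parity (l + d)) (\<lambda>k x. t (real k * x))"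
    by (intro fun_span_sum) auto
  then show ?thesis by (simp add: poly_altdef sum_distrib_right mult.assoc)
qed

section \<open>Trigonometric sums and orthogonality\<close>

definition trig_fun :: "int \<Rightarrow> real \<Rightarrow> real" where
  "trig_fun m = (if even m then cos else sin)"

text \<open>For odd \<open>l\<close> the indices in \<open>trig_index\<close> start at 1, so the
  truncated subtraction is exact there.\<close>

definition trig_freq :: "nat \<Rightarrow> nat \<Rightarrow> nat" where
  "trig_freq l k = (if even l then 2 * k else 2 * k - 1)"

lemma finite_trig_index [simp]: "finite (trig_index l m)"
  by (simp add: trig_index_def)

lemma trig_sum_eq:
  "trig_sum l m a x = (\<Sum>k\<in>trig_index l m. a k * trig_fun m (real (trig_freq l k) * x))"
  unfolding trig_sum_def trig_fun_def
  by (auto simp: trig_freq_def trig_index_def of_nat_diff intro!: sum.cong)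

lemma has_integral_cos_int:
  "((\<lambda>x. cos (of_int n * x)) has_integral (if n = 0 then pi else 0)) {0..pi}"
proof (cases "n = 0")
  case True
  then show ?thesis using has_integral_const_real[of "1::real" 0 pi] by simp
next
  case False
  have "((\<lambda>x. cos (of_int n * x)) has_integral sin (of_int n * pi) / of_int n - sin (of_int n * 0) / of_int n) {0..pi}"
    using False
    by (intro fundamental_theorem_of_calculus)
      (auto simp: has_real_derivative_iff_has_vector_derivative[symmetric] intro!: derivative_eq_intros)
  then show ?thesis using False by (simp add: sin_times_pi_eq_0 mult.commute)
qed

text \<open>Product-to-sum formulas again. The term with \<open>i + j = 0\<close> covers the
  constant frequency, whose squared norm is pi for cosines and 0 for sines.\<close>

lemma has_integral_trig_orthogonal:
  "((\<lambda>x. trig_fun m (real i * x) * trig_fun m (real j * x)) has_integral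
      (of_bool (i = j) * pi + (if even m then 1 else -1) * of_bool (i + j = 0) * pi) / 2) {0..pi}"
proof -
  let ?s = "if even m then 1 else -1 :: real"
  have "((\<lambda>x. (cos (of_int (int i - int j) * x) + ?s * cos (of_int (int i + int j) * x)) / 2) has_integral
      ((if int i - int j = 0 then pi else 0) + ?s * (if int i + int j = 0 then pi else 0)) / 2) {0..pi}"
    by (intro has_integral_divide has_integral_add has_integral_mult_right has_integral_cos_int)
  moreover have "(cos (of_int (int i - int j) * x) + ?s * cos (of_int (int i + int j) * x)) / 2 =
      trig_fun m (real i * x) * trig_fun m (real j * x)" for x
    by (simp add: trig_fun_def left_diff_distrib distrib_right cos_add cos_diff)
  ultimately show ?thesis by (auto simp: of_bool_def split: if_splits)
qed

text \<open>Integrating the vanishing sum against the \<open>j\<close>-th basis function isolates a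
  nonzero multiple of \<open>a j\<close>.\<close>

lemma trig_sum_eq_0:
  assumes "\<And>x. x \<in> {0..pi} \<Longrightarrow> trig_sum l m a x = 0" and j: "j \<in> trig_index l m"
  shows "a j = 0"
proof -
  let ?c = "\<lambda>k. (of_bool (trig_freq l k = trig_freq l j) * pi +
     (if even m then 1 else -1) * of_bool (trig_freq l k + trig_freq l j = 0) * pi) / 2"
  have H: "((\<lambda>x. \<Sum>k\<in>trig_index l m. a k * (trig_fun m (real (trig_freq l k) * x) * trig_fun m (real (trig_freq l j) * x)))
      has_integral (\<Sum>k\<in>trig_index l m. a k * ?c k)) {0..pi}"
    by (intro has_integral_sum has_integral_mult_right has_integral_trig_orthogonal) simp
  have *: "(\<Sum>k\<in>trig_index l m. a k * (trig_fun m (real (trig_freq l k) * x) * trig_fun m (real (trig_freq l j) * x))) = 0"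
    if "x \<in> {0..pi}" for x
    using assms(1)[OF that] by (simp add: trig_sum_eq mult.assoc[symmetric] flip: sum_distrib_right)
  have "((\<lambda>x. 0) has_integral (\<Sum>k\<in>trig_index l m. a k * ?c k)) {0..pi}"
    by (rule has_integral_eq[OF * H])
  then have "(\<Sum>k\<in>trig_index l m. a k * ?c k) = 0"
    using has_integral_0 by (rule has_integral_unique)
  moreover have "?c k = 0" if "k \<in> trig_index l m" "k \<noteq> j" for k
  proof -
    have "trig_freq l k \<noteq> trig_freq l j"
      using that j unfolding trig_freq_def trig_index_def
      by (cases "even l"; cases "even m") simp_all
    moreover from this have "trig_freq l k + trig_freq l j \<noteq> 0" by linarith
    ultimately show ?thesis by simp
  qed
  then have "(\<Sum>k\<in>trig_index l m. a k * ?c k) = a j * ?c j"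
    using j by (subst sum.remove[of _ j]) auto
  \<comment> \<open>The constant frequency, for which a sine would have norm 0, is absent from the
    index set when \<open>m\<close> is odd.\<close>
  moreover have "?c j \<noteq> 0"
  proof -
    have "trig_freq l j \<noteq> 0" if "odd m"
      using that j unfolding trig_freq_def trig_index_def by (cases "even l") simp_all
    then show ?thesis by (cases "even m") simp_all
  qed
  ultimately show ?thesis by simp
qed

section \<open>Legendre functions as trigonometric sums\<close>

lemma hatP_eq:
  obtains C where "\<And>y. hatP l m y =
    C * (sqrt (1 - y\<^sup>2) ^ nat \<bar>m\<bar> * poly ((pderiv ^^ nat \<bar>m\<bar>) (legendre l)) y)"
proof (cases "0 \<le> m")
  case True
  \<comment> \<open>All factors independent of \<open>y\<close> go into the constant, so both signs
    of \<open>m\<close> reduce to order \<bar>\<open>m\<close>\<bar>.\<close>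
  then show thesis
    by (intro that[of "(-1) powi m * harmonic_norm l m * (-1) ^ nat m"])
      (simp add: hatP_def assoc_legendre_def assoc_legendre_nonneg_def)
next
  case False
  let ?M = "nat (- m)"
  from False show thesis
    by (intro that[of "(-1) powi m * harmonic_norm l m * ((-1) ^ ?M * (fact (l - ?M) / fact (l + ?M))) * (-1) ^ ?M"])
      (simp add: hatP_def assoc_legendre_def assoc_legendre_nonneg_def)
qed

lemma continuous_on_hatP [continuous_intros]:
  assumes "continuous_on A f"
  shows "continuous_on A (\<lambda>x. hatP l m (f x))"
proof -
  obtain C where "\<And>y. hatP l m y =
    C * (sqrt (1 - y\<^sup>2) ^ nat \<bar>m\<bar> * poly ((pderiv ^^ nat \<bar>m\<bar>) (legendre l)) y)"
    using hatP_eq by blast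
  then show ?thesis by (auto intro!: continuous_intros assms)
qed

text \<open>For odd \<open>m\<close> the sign built into \<open>hatP_angle\<close> turns the power
  of \<bar>sin x\<bar> into the same power of sin x; for even \<open>m\<close> the two powers
  agree.\<close>

lemma hatP_angle_eq:
  obtains C where "\<And>x. hatP_angle l m x =
    C * (sin x ^ nat \<bar>m\<bar> * poly ((pderiv ^^ nat \<bar>m\<bar>) (legendre l)) (cos x))"
proof -
  have odd_m: "odd m \<longleftrightarrow> odd (nat \<bar>m\<bar>)" by (simp add: even_nat_iff)
  have sqrt: "sqrt (1 - (cos x)\<^sup>2) = \<bar>sin x\<bar>" for x
    by (simp add: sin_squared_eq[symmetric])
  obtain C where C: "\<And>y. hatP l m y =
    C * (sqrt (1 - y\<^sup>2) ^ nat \<bar>m\<bar> * poly ((pderiv ^^ nat \<bar>m\<bar>) (legendre l)) y)"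
    using hatP_eq by blast
  have "hatP_angle l m x = C * (sin x ^ nat \<bar>m\<bar> * poly ((pderiv ^^ nat \<bar>m\<bar>) (legendre l)) (cos x))" for x
    unfolding hatP_angle_def C sqrt odd_m
    by (auto simp: abs_if power_minus_odd)
  then show thesis by (rule that)
qed

lemma hatP_angle_fun_span:
  assumes "\<bar>m\<bar> \<le> int l"
  shows "hatP_angle l m \<in> fun_span (same_parity l) (\<lambda>k x. trig_fun m (real k * x))"
proof -
  define M where "M = nat \<bar>m\<bar>"
  have M: "M \<le> l" "even M \<longleftrightarrow> even m" using assms by (auto simp: M_def even_nat_iff)
  obtain C where C: "\<And>x. hatP_angle l m x = C * (sin x ^ M * poly ((pderiv ^^ M) (legendre l)) (cos x))"
    unfolding M_def using hatP_angle_eq by blast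
  \<comment> \<open>Pairs of sines are rewritten by sin^2 = 1 - cos^2. What remains is the
    polynomial \<open>q\<close> in cos, times one extra sine if \<open>m\<close> is odd.\<close>
  define h where "h = M div 2"
  define q where "q = [:1, 0, -1:] ^ h * (pderiv ^^ M) (legendre l)"
  have deg_q: "degree q \<le> 2 * h + (l - M)"
    unfolding q_def by (rule order.trans[OF degree_mult_le])
      (auto simp: degree_higher_pderiv intro!: add_mono order.trans[OF degree_power_le])
  have "has_parity (l - M) q"
    unfolding q_def
    using has_parity_mult[OF has_parity_power[OF has_parity_quadratic] has_parity_higher_pderiv[of "l - M" M "legendre l"], of h 1 "-1"] M
    by (simp add: has_parity_legendre)
  then have par_q: "has_parity (2 * h + (l - M)) q" by (simp add: has_parity_def)
  have poly_q: "sin x ^ (2 * h) * poly ((pderiv ^^ M) (legendre l)) (cos x) = poly q (cos x)" for x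
    by (simp add: q_def poly_power power_mult sin_squared_eq power2_eq_square[of "cos x"])
  show ?thesis
  proof (cases "even m")
    case True
    then have "M = 2 * h" using M(2) by (simp add: h_def)
    \<comment> \<open>The constant 1 is the starting function; the degree bound is
      \<open>2 * h + (l - M) = l\<close>.\<close>
    have "(\<lambda>x. cos (real 0 * x)) \<in> fun_span (same_parity 0) (\<lambda>k x. cos (real k * x))"
      by (rule fun_span_base) (auto simp: same_parity_def)
    from poly_cos_mult_fun_span[OF _ this deg_q par_q]
    have "(\<lambda>x. poly q (cos x)) \<in> fun_span (same_parity l) (\<lambda>k x. cos (real k * x))"
      using M \<open>M = 2 * h\<close> by simp
    from fun_span_scale[OF this, of C] show ?thesis
      using True \<open>M = 2 * h\<close> by (simp add: trig_fun_def C[abs_def] flip: poly_q)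
  next
    case False
    then have h: "M = Suc (2 * h)" using M(2) by (simp add: h_def)
    \<comment> \<open>The leftover sine is the starting function, of frequency 1; now
      \<open>1 + 2 * h + (l - M) = l\<close>.\<close>
    have "(\<lambda>x. sin (real 1 * x)) \<in> fun_span (same_parity 1) (\<lambda>k x. sin (real k * x))"
      by (rule fun_span_base) (auto simp: same_parity_def)
    from poly_cos_mult_fun_span[OF _ this deg_q par_q]
    have "(\<lambda>x. poly q (cos x) * sin x) \<in> fun_span (same_parity l) (\<lambda>k x. sin (real k * x))"
      using M h by simp
    from fun_span_scale[OF this, of C] show ?thesis
      using False h by (simp add: trig_fun_def C[abs_def] mult_ac flip: poly_q)
  qed
qed

lemma hatP_angle_trig_sum_exists:
  assumes "\<bar>m\<bar> \<le> int l"
  shows "\<exists>a. \<forall>x. hatP_angle l m x = trig_sum l m a x"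
proof -
  let ?b = "\<lambda>k x. trig_fun m (real (trig_freq l k) * x)"
  have "hatP_angle l m \<in> fun_span (trig_index l m) ?b"
  proof (rule fun_span_trans[OF hatP_angle_fun_span[OF assms]])
    fix i assume i: "i \<in> same_parity l"
    show "(\<lambda>x. trig_fun m (real i * x)) \<in> fun_span (trig_index l m) ?b"
    proof (cases "odd m \<and> i = 0")
      case True
      \<comment> \<open>The sine of frequency 0 is the zero function, so its missing index does no
        harm.\<close>
      then show ?thesis by (simp add: trig_fun_def fun_span_0)
    next
      case False
      \<comment> \<open>This inverts \<open>trig_freq l\<close> on frequencies of either
        parity.\<close>
      define k where "k = (i + 1) div 2"
      from i have "trig_freq l k = i"
        by (auto simp: k_def trig_freq_def same_parity_def)
      moreover have "k \<in> trig_index l m"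
      proof -
        have "k \<le> (l + 1) div 2" "odd l \<Longrightarrow> 1 \<le> k" "odd m \<Longrightarrow> 1 \<le> k"
          using i False by (auto simp: k_def same_parity_def intro!: div_le_mono Suc_leI elim!: oddE)
        then show ?thesis by (auto simp: trig_index_def)
      qed
      ultimately show ?thesis
        using fun_span_base[of "trig_index l m" k ?b] by simp
    qed
  qed
  then show ?thesis by (simp add: fun_span_def trig_sum_eq)
qed

text \<open>On [0, pi] the sine is nonnegative and \<open>hatP_angle\<close> agrees with
  \<open>hatP\<close>, so the coefficients of the global expansion satisfy, and by orthogonality
  are, the description in \<open>trig_coeff\<close>.\<close>

lemma hatP_angle_eq_trig_sum:
  assumes "\<bar>m\<bar> \<le> int l"
  shows "hatP_angle l m x = trig_sum l m (trig_coeff l m) x"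
proof -
  let ?P = "\<lambda>a. (\<forall>k. k \<notin> trig_index l m \<longrightarrow> a k = 0) \<and> (\<forall>th\<in>{0..pi}. hatP l m (cos th) = trig_sum l m a th)"
  have hatP: "hatP_angle l m th = hatP l m (cos th)" if "th \<in> {0..pi}" for th
    using sin_ge_zero[of th] that by (auto simp: hatP_angle_def)
  obtain a0 where a0: "\<And>x. hatP_angle l m x = trig_sum l m a0 x"
    using hatP_angle_trig_sum_exists[OF assms] by blast
  \<comment> \<open>Values off the index set are reset to 0, as the definite description
    demands.\<close>
  define a where "a k = (if k \<in> trig_index l m then a0 k else 0)" for k
  have a: "hatP_angle l m x = trig_sum l m a x" for x
    unfolding a0 trig_sum_eq by (simp add: a_def)
  have "?P a" using hatP a by (auto simp: a_def)
  moreover have "a' = a" if "?P a'" for a'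
  proof
    fix k
    have "trig_sum l m (\<lambda>k. a' k - a k) th = 0" if "th \<in> {0..pi}" for th
    proof -
      have "trig_sum l m (\<lambda>k. a' k - a k) th = trig_sum l m a' th - trig_sum l m a th"
        by (simp add: trig_sum_eq left_diff_distrib sum_subtractf)
      then show ?thesis using \<open>?P a\<close> \<open>?P a'\<close> that by auto
    qed
    from trig_sum_eq_0[OF this, of k] show "a' k = a k"
      using \<open>?P a\<close> \<open>?P a'\<close> by (cases "k \<in> trig_index l m") auto
  qed
  ultimately have "trig_coeff l m = a" unfolding trig_coeff_def by (rule the_equality)
  then show ?thesis by (simp add: a)
qed

section \<open>The closed formula for Q\<close>

lemma has_integral_legendre_cos_sin:
  "((\<lambda>x. poly (legendre n) x * cos (f * (lam * x + rho)) * sin (lam * x + rho)) has_integral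
     1/2 * (S_osc n ((f + 1) * lam) ((f + 1) * rho) - S_osc n ((f - 1) * lam) ((f - 1) * rho))) {-1..1}"
  and has_integral_legendre_sin_sin:
  "((\<lambda>x. poly (legendre n) x * sin (f * (lam * x + rho)) * sin (lam * x + rho)) has_integral
     1/2 * (C_osc n ((f - 1) * lam) ((f - 1) * rho) - C_osc n ((f + 1) * lam) ((f + 1) * rho))) {-1..1}"
proof -
  have arg: "(f + 1) * lam * x + (f + 1) * rho = f * (lam * x + rho) + (lam * x + rho)"
     "(f - 1) * lam * x + (f - 1) * rho = f * (lam * x + rho) - (lam * x + rho)" for x
    by (simp_all add: algebra_simps)
  show "((\<lambda>x. poly (legendre n) x * cos (f * (lam * x + rho)) * sin (lam * x + rho)) has_integral
     1/2 * (S_osc n ((f + 1) * lam) ((f + 1) * rho) - S_osc n ((f - 1) * lam) ((f - 1) * rho))) {-1..1}"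
    using has_integral_mult_right[OF has_integral_diff[OF has_integral_legendre_sin has_integral_legendre_sin], of "1/2" n
        "(f + 1) * lam" "(f + 1) * rho" n "(f - 1) * lam" "(f - 1) * rho"]
    unfolding arg sin_add sin_diff by (simp add: algebra_simps)
  show "((\<lambda>x. poly (legendre n) x * sin (f * (lam * x + rho)) * sin (lam * x + rho)) has_integral
     1/2 * (C_osc n ((f - 1) * lam) ((f - 1) * rho) - C_osc n ((f + 1) * lam) ((f + 1) * rho))) {-1..1}"
    using has_integral_mult_right[OF has_integral_diff[OF has_integral_legendre_cos has_integral_legendre_cos], of "1/2" n
        "(f - 1) * lam" "(f - 1) * rho" n "(f + 1) * lam" "(f + 1) * rho"]
    unfolding arg cos_add cos_diff by (simp add: algebra_simps)
qed


lemma set_lborel_integral_eq: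
  fixes f :: "real \<Rightarrow> real"
  assumes "continuous_on {a..b} f" "(f has_integral I) {a..b}"
  shows "(LBINT x:{a..b}. f x) = I"
  using set_borel_integral_eq_integral(2)[OF borel_integrable_atLeastAtMost'[OF assms(1)]] assms(2)
  by (simp add: integral_unique)

lemma continuous_on_trig_sum [continuous_intros]:
  fixes f :: "real \<Rightarrow> real"
  assumes "continuous_on A f"
  shows "continuous_on A (\<lambda>x. trig_sum l m a (f x))"
  unfolding trig_sum_eq trig_fun_def
  by (auto intro!: continuous_intros assms)

lemma Q_int_angle_eq:
  assumes "\<bar>m\<bar> \<le> int l"
  shows "Q_int_angle n l m lam rho = Q_formula n l m lam rho"
proof -
  define G where "G f = (if even m
     then 1/2 * (S_osc n ((f + 1) * lam) ((f + 1) * rho) - S_osc n ((f - 1) * lam) ((f - 1) * rho))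
     else 1/2 * (C_osc n ((f - 1) * lam) ((f - 1) * rho) - C_osc n ((f + 1) * lam) ((f + 1) * rho)))" for f
  have G: "((\<lambda>x. poly (legendre n) x * trig_fun m (f * (lam * x + rho)) * sin (lam * x + rho)) has_integral G f) {-1..1}" for f
    by (simp only: G_def trig_fun_def has_integral_legendre_cos_sin has_integral_legendre_sin_sin split: if_split) simp
  have "((\<lambda>x. \<Sum>k\<in>trig_index l m. trig_coeff l m k *
        (poly (legendre n) x * trig_fun m (real (trig_freq l k) * (lam * x + rho)) * sin (lam * x + rho))) has_integral
      (\<Sum>k\<in>trig_index l m. trig_coeff l m k * G (real (trig_freq l k)))) {-1..1}"
    by (intro has_integral_sum has_integral_mult_right G) simp
  moreover have "(\<Sum>k\<in>trig_index l m. trig_coeff l m k *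
        (poly (legendre n) x * trig_fun m (real (trig_freq l k) * (lam * x + rho)) * sin (lam * x + rho))) =
      poly (legendre n) x * trig_sum l m (trig_coeff l m) (lam * x + rho) * sin (lam * x + rho)" for x
    by (simp add: trig_sum_eq sum_distrib_left sum_distrib_right mult_ac)
  ultimately have "Q_int_angle n l m lam rho = (\<Sum>k\<in>trig_index l m. trig_coeff l m k * G (real (trig_freq l k)))"
    unfolding Q_int_angle_def hatP_angle_eq_trig_sum[OF assms]
    by (intro set_lborel_integral_eq) (auto intro!: continuous_intros)
  also have "\<dots> = Q_formula n l m lam rho"
  proof -
    \<comment> \<open>The shifted frequencies f + 1 and f - 1 are p_k and p_(k-1) for f = 2k, and
      q_k and q_(k-1) for f = 2k - 1.\<close>
    have p: "real (trig_freq l k) + 1 = p_freq (int k)" "real (trig_freq l k) - 1 = p_freq (int k - 1)" if "even l" for k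
      using that by (simp_all add: trig_freq_def p_freq_def)
    have q: "real (trig_freq l k) + 1 = q_freq (int k)" "real (trig_freq l k) - 1 = q_freq (int k - 1)"
      if "odd l" "k \<in> {1..(l + 1) div 2}" for k
      using that by (simp_all add: trig_freq_def q_freq_def of_nat_diff)
    show ?thesis
    proof (cases "even l")
      case True
      then show ?thesis
        by (simp add: Q_formula_def G_def p[OF True] trig_index_def sum_distrib_left mult_ac)
    next
      case False
      then have "(\<Sum>k\<in>trig_index l m. trig_coeff l m k * G (real (trig_freq l k))) =
        (\<Sum>k=1..(l + 1) div 2. trig_coeff l m k * (if even m
           then 1/2 * (S_osc n (q_freq (int k) * lam) (q_freq (int k) * rho)
             - S_osc n (q_freq (int k - 1) * lam) (q_freq (int k - 1) * rho))
           else 1/2 * (C_osc n (q_freq (int k - 1) * lam) (q_freq (int k - 1) * rho)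
             - C_osc n (q_freq (int k) * lam) (q_freq (int k) * rho))))"
        unfolding G_def by (intro sum.cong) (simp_all only: trig_index_def if_False q[OF False])
      with False show ?thesis
        by (simp add: Q_formula_def sum_distrib_left mult_ac)
    qed
  qed
  finally show ?thesis .
qed

text \<open>Under either alternative the integrands of \<open>Q_int\<close> and
  \<open>Q_int_angle\<close> coincide at every point of [-1, 1].\<close>

lemma Q_int_eq:
  assumes "\<bar>m\<bar> \<le> int l" "even m \<or> (\<forall>x\<in>{-1..1}. 0 \<le> sin (lam * x + rho))"
  shows "Q_int n l m lam rho = Q_formula n l m lam rho"
proof -
  have "Q_int n l m lam rho = Q_int_angle n l m lam rho"
    unfolding Q_int_def Q_int_angle_def
    using assms(2) by (intro set_lebesgue_integral_cong) (auto simp: hatP_angle_def not_less[symmetric])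
  then show ?thesis using Q_int_angle_eq[OF assms(1)] by simp
qed

section \<open>The coefficient formula\<close>

lemma has_integral_half_width:
  fixes f :: "real \<Rightarrow> 'a::real_normed_vector"
  assumes "g (k - 1) < g k"
    and "((\<lambda>x. f (half_width g k * x + centre g k)) has_integral J) {-1..1}"
  shows "(f has_integral half_width g k *\<^sub>R J) {g (k - 1)..g k}"
proof -
  let ?h = "half_width g k"
  have h: "?h > 0" using assms(1) by (simp add: half_width_def)
  have "(g (k - 1) - centre g k) /\<^sub>R ?h = -1" "(g k - centre g k) /\<^sub>R ?h = 1"
    using h by (simp_all add: half_width_def centre_def field_simps)
  with has_integral_affinity_iff[OF h, of f "centre g k" "?h *\<^sub>R J" "g (k - 1)" "g k"] assms(2) h
  show ?thesis by simp
qed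

text \<open>Here and in \<open>polar_integrand\<close> the inverse element map is an explicit affine
  formula instead of \<open>inv_into\<close>, which gives continuity on every set.\<close>

definition azimuth_integrand :: "nat \<Rightarrow> (nat \<Rightarrow> real) \<Rightarrow> (nat \<Rightarrow> real) \<Rightarrow> int \<Rightarrow> nat \<Rightarrow> nat \<Rightarrow> real \<Rightarrow> complex" where
  "azimuth_integrand N xi ph m i t y =
     of_real (poly (lagrange_basis N xi i) ((y - centre ph t) / half_width ph t)) *
       exp (- (\<i> * of_int m * of_real y))"

definition polar_integrand :: "nat \<Rightarrow> (nat \<Rightarrow> real) \<Rightarrow> (nat \<Rightarrow> real) \<Rightarrow> nat \<Rightarrow> int \<Rightarrow> nat \<Rightarrow> nat \<Rightarrow> real \<Rightarrow> real" where
  "polar_integrand N xi th l m j s x =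
     poly (lagrange_basis N xi j) ((x - centre th s) / half_width th s) * hatP l m (cos x) * sin x"

lemma continuous_on_azimuth_integrand: "continuous_on A (azimuth_integrand N xi ph m i t)"
  unfolding azimuth_integrand_def[abs_def] divide_inverse by (intro continuous_intros)

lemma continuous_on_polar_integrand: "continuous_on A (polar_integrand N xi th l m j s)"
  unfolding polar_integrand_def[abs_def] divide_inverse by (intro continuous_intros)

lemma has_integral_azimuth_integrand:
  assumes "ph (t - 1) < ph t" "i \<le> N"
  shows "(azimuth_integrand N xi ph m i t has_integral azimuth_factor N xi ph m i t) {ph (t - 1)..ph t}"
proof -
  let ?h = "half_width ph t" and ?c = "centre ph t" and ?v = "lagrange_coeff N xi i"
  have h: "?h > 0" using assms(1) by (simp add: half_width_def)
  have "((\<lambda>x. exp (- (\<i> * of_int m * of_real ?c)) * (\<Sum>n=0..N. of_real (?v n) *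
        (of_real (poly (legendre n) x) * exp (- (\<i> * of_real (of_int m * ?h * x)))))) has_integral
      exp (- (\<i> * of_int m * of_real ?c)) *
        (\<Sum>n=0..N. of_real (?v n) * (2 * \<i> powi (- int n) * of_real (sph_bessel n (of_int m * ?h))))) {-1..1}"
    by (intro has_integral_mult_right has_integral_sum has_integral_legendre_exp_neg) simp
  moreover have "exp (- (\<i> * of_int m * of_real ?c)) * (\<Sum>n=0..N. of_real (?v n) *
        (of_real (poly (legendre n) x) * exp (- (\<i> * of_real (of_int m * ?h * x))))) =
      azimuth_integrand N xi ph m i t (?h * x + ?c)" for x
  proof -
    have "exp (- (\<i> * of_int m * of_real (?h * x + ?c))) =
        exp (- (\<i> * of_int m * of_real ?c)) * exp (- (\<i> * of_real (of_int m * ?h * x)))"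
      by (simp add: exp_add[symmetric] algebra_simps)
    then show ?thesis
      using h by (simp add: azimuth_integrand_def poly_lagrange_basis[OF assms(2)]
          sum_distrib_left sum_distrib_right mult_ac)
  qed
  ultimately have "(azimuth_integrand N xi ph m i t has_integral ?h *\<^sub>R (exp (- (\<i> * of_int m * of_real ?c)) *
        (\<Sum>n=0..N. of_real (?v n) * (2 * \<i> powi (- int n) * of_real (sph_bessel n (of_int m * ?h)))))) {ph (t - 1)..ph t}"
    using assms(1) by (intro has_integral_half_width) auto
  moreover have "?h *\<^sub>R (exp (- (\<i> * of_int m * of_real ?c)) *
        (\<Sum>n=0..N. of_real (?v n) * (2 * \<i> powi (- int n) * of_real (sph_bessel n (of_int m * ?h))))) =
      azimuth_factor N xi ph m i t"
  proof (cases "m = 0")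
    case True
    \<comment> \<open>At argument 0 only \<open>n = 0\<close> survives, which yields the separate
      case of \<open>azimuth_factor\<close>.\<close>
    have "(\<Sum>n=0..N. of_real (?v n) * (2 * \<i> powi (- int n) * of_real (sph_bessel n 0))) =
        (\<Sum>n=0..N. if n = 0 then 2 * complex_of_real (?v 0) else 0)"
      by (intro sum.cong) (auto simp: sph_bessel_0_right)
    with True show ?thesis
      by (simp add: azimuth_factor_def scaleR_conv_of_real)
  next
    case False
    then show ?thesis
      by (simp add: azimuth_factor_def scaleR_conv_of_real mult_ac)
  qed
  ultimately show ?thesis by simp
qed

lemma has_integral_polar_integrand:
  assumes "th (s - 1) < th s" "j \<le> N"
  shows "(polar_integrand N xi th l m j s has_integral polar_factor N xi th l m j s) {th (s - 1)..th s}"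
proof -
  let ?h = "half_width th s" and ?c = "centre th s" and ?v = "lagrange_coeff N xi j"
  have h: "?h > 0" using assms(1) by (simp add: half_width_def)
  have Q: "((\<lambda>x. poly (legendre n) x * hatP l m (cos (?h * x + ?c)) * sin (?h * x + ?c)) has_integral
      Q_int n l m ?h ?c) {-1..1}" (is "(?f has_integral _) _") for n
  proof -
    have c: "continuous_on {-1..1} ?f" by (intro continuous_intros)
    then have "(?f has_integral integral {-1..1} ?f) {-1..1}"
      by (intro integrable_integral integrable_continuous_real)
    with set_lborel_integral_eq[OF c this] show ?thesis by (simp add: Q_int_def)
  qed
  have "((\<lambda>x. \<Sum>n=0..N. ?v n * (poly (legendre n) x * hatP l m (cos (?h * x + ?c)) * sin (?h * x + ?c)))
      has_integral (\<Sum>n=0..N. ?v n * Q_int n l m ?h ?c)) {-1..1}"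
    by (intro has_integral_sum has_integral_mult_right Q) simp
  moreover have "(\<Sum>n=0..N. ?v n * (poly (legendre n) x * hatP l m (cos (?h * x + ?c)) * sin (?h * x + ?c))) =
      polar_integrand N xi th l m j s (?h * x + ?c)" for x
    using h by (simp add: polar_integrand_def poly_lagrange_basis[OF assms(2)]
        sum_distrib_left sum_distrib_right mult_ac)
  ultimately show ?thesis
    using has_integral_half_width[OF assms(1), where f = "polar_integrand N xi th l m j s"]
    by (simp add: polar_factor_def)
qed

lemma has_integral_prod:
  fixes f g :: "real \<Rightarrow> complex"
  assumes "(f has_integral I) {a..b}" "(g has_integral J) {c..d}"
    and "continuous_on {a..b} f" "continuous_on {c..d} g"
  shows "((\<lambda>z. f (fst z) * g (snd z)) has_integral I * J) (cbox (a, c) (b, d))"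
proof -
  have cont: "continuous_on (cbox (a, c) (b, d)) (\<lambda>z. f (fst z) * g (snd z))"
    by (intro continuous_intros continuous_on_compose2[OF assms(3)] continuous_on_compose2[OF assms(4)])
      (auto simp: cbox_Pair_eq)
  have "integral (cbox (a, c) (b, d)) (\<lambda>z. f (fst z) * g (snd z)) = I * J"
    unfolding integral_prod_continuous[OF cont] using assms(1,2)
    by (simp add: integral_unique)
  with integrable_continuous[OF cont] show ?thesis by (metis integrable_integral)
qed

lemma element_eq_cbox: "element th ph s t = cbox (th (s - 1), ph (t - 1)) (th s, ph t)"
  by (simp add: element_def cbox_Pair_eq)

lemma element_map_inv_eq:
  assumes "th (s - 1) < th s" "ph (t - 1) < ph t" "(x, y) \<in> element th ph s t"
  shows "element_map_inv th ph s t (x, y) =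
    ((x - centre th s) / half_width th s, (y - centre ph t) / half_width ph t)"
  unfolding element_map_inv_def
proof (rule inv_into_f_eq)
  have h: "half_width th s > 0" "half_width ph t > 0"
    using assms by (simp_all add: half_width_def)
  then show "inj_on (element_map th ph s t) ({-1..1} \<times> {-1..1})"
    by (auto simp: inj_on_def element_map_def)
  show "element_map th ph s t ((x - centre th s) / half_width th s, (y - centre ph t) / half_width ph t) = (x, y)"
    using h by (simp add: element_map_def)
  show "((x - centre th s) / half_width th s, (y - centre ph t) / half_width ph t) \<in> {-1..1} \<times> {-1..1}"
    using h assms by (auto simp: field_simps) (auto simp: element_def half_width_def centre_def field_simps)
qed

lemma cnj_sph_harmonic:
  "cnj (sph_harmonic l m x y) = of_real (hatP l m (cos x)) * exp (- (\<i> * of_int m * of_real y))"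
  by (simp add: sph_harmonic_def exp_cnj)

lemma absolutely_integrable_finite_UN:
  fixes f :: "'a::euclidean_space \<Rightarrow> 'b::euclidean_space"
  assumes "finite I" "\<And>i. i \<in> I \<Longrightarrow> f absolutely_integrable_on S i"
  shows "f absolutely_integrable_on (\<Union>i\<in>I. S i)"
  using assms by (induction I rule: finite_induct) (auto intro!: absolutely_integrable_Un)

text \<open>\<open>u\<close> is prescribed only in the interior of the element. There the integrand
  equals a continuous sum of products, integrated by Fubini, and the frontier is negligible.\<close>

lemma has_integral_element:
  assumes grid: "th (s - 1) < th s" "ph (t - 1) < ph t"
    and u: "\<And>z. z \<in> interior (element th ph s t) \<Longrightarrow>
           u z = (\<Sum>i=0..N. \<Sum>j=0..N. U i j * of_real (nodal_basis N xi i j (element_map_inv th ph s t z)))"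
    and f: "f = (\<lambda>z. u z * cnj (sph_harmonic l m (fst z) (snd z)) * of_real (sin (fst z)))"
  shows "(f has_integral (\<Sum>i=0..N. \<Sum>j=0..N.
        U i j * azimuth_factor N xi ph m i t * of_real (polar_factor N xi th l m j s))) (element th ph s t)"
    and "f absolutely_integrable_on element th ph s t"
proof -
  define F where "F z = (\<Sum>i=0..N. \<Sum>j=0..N. U i j *
    (of_real (polar_integrand N xi th l m j s (fst z)) * azimuth_integrand N xi ph m i t (snd z)))" for z
  let ?a = "(th (s - 1), ph (t - 1))" and ?b = "(th s, ph t)"
  have "(F has_integral (\<Sum>i=0..N. \<Sum>j=0..N. U i j *
      (of_real (polar_factor N xi th l m j s) * azimuth_factor N xi ph m i t))) (cbox ?a ?b)"
    unfolding F_def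
    by (intro has_integral_sum has_integral_mult_right has_integral_prod continuous_intros
        has_integral_azimuth_integrand has_integral_linear[OF has_integral_polar_integrand bounded_linear_of_real, unfolded o_def]
        continuous_on_azimuth_integrand continuous_on_polar_integrand grid) auto
  then have F_int: "(F has_integral (\<Sum>i=0..N. \<Sum>j=0..N.
      U i j * azimuth_factor N xi ph m i t * of_real (polar_factor N xi th l m j s))) (cbox ?a ?b)"
    by (simp add: mult_ac)
  have F_cont: "continuous_on (cbox ?a ?b) F"
    unfolding F_def
    by (intro continuous_intros continuous_on_compose2[OF continuous_on_azimuth_integrand]
        continuous_on_compose2[OF continuous_on_polar_integrand]) auto
  have eq: "f z = F z" if z: "z \<in> box ?a ?b" for z
  proof -
    obtain x y where xy: "z = (x, y)" by (cases z)
    from z have "z \<in> interior (element th ph s t)"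
      by (simp add: element_eq_cbox interior_cbox)
    moreover from this have "z \<in> element th ph s t" using interior_subset by blast
    ultimately show ?thesis
      unfolding f F_def
      by (simp add: u xy element_map_inv_eq[OF grid] nodal_basis_def cnj_sph_harmonic
          azimuth_integrand_def polar_integrand_def sum_distrib_left sum_distrib_right mult_ac)
  qed
  show "(f has_integral (\<Sum>i=0..N. \<Sum>j=0..N.
        U i j * azimuth_factor N xi ph m i t * of_real (polar_factor N xi th l m j s))) (element th ph s t)"
    unfolding element_eq_cbox using F_int eq by (rule has_integral_spike_interior)
  show "f absolutely_integrable_on element th ph s t"
    unfolding element_eq_cbox
    by (rule absolutely_integrable_spike[OF absolutely_integrable_continuous[OF F_cont] negligible_frontier_interval])
      (use eq in blast)
qed

section \<open>Summation over the partition\<close>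

lemma negligible_Int_elements:
  assumes "interior (element th ph s t) \<inter> interior (element th ph s' t') = {}"
  shows "negligible (element th ph s t \<inter> element th ph s' t')"
proof -
  \<comment> \<open>Two boxes meet in a box; its open part lies in both interiors and is therefore
    empty, so the intersection is degenerate.\<close>
  obtain a b where ab: "element th ph s t \<inter> element th ph s' t' = cbox a b"
    unfolding element_eq_cbox Int_interval by blast
  have "box a b = {}"
    using assms interior_cbox[of a b] unfolding ab[symmetric] by simp
  then show ?thesis unfolding ab by (simp add: negligible_interval)
qed

lemma sph_coeff_eq:
  assumes partition: "sphere_partition E th ph s t"
    and u: "\<And>e z. e \<in> {1..E} \<Longrightarrow> z \<in> interior (element th ph (s e) (t e)) \<Longrightarrow>
           u z = (\<Sum>i=0..N. \<Sum>j=0..N. U e i j *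
                    of_real (nodal_basis N xi i j (element_map_inv th ph (s e) (t e) z)))"
  shows "sph_coeff u l m =
              (\<Sum>e=1..E. \<Sum>i=0..N. \<Sum>j=0..N.
                 U e i j * azimuth_factor N xi ph m i (t e) * of_real (polar_factor N xi th l m j (s e)))"
    (is "_ = ?rhs")
proof -
  define f where "f = (\<lambda>z. u z * cnj (sph_harmonic l m (fst z) (snd z)) * of_real (sin (fst z)))"
  let ?R = "{0..pi} \<times> {0..2 * pi} :: (real \<times> real) set" and ?R' = "{0..pi} \<times> {0..<2 * pi} :: (real \<times> real) set"
  have grid: "th (s e - 1) < th (s e)" "ph (t e - 1) < ph (t e)" if "e \<in> {1..E}" for e
    using partition that unfolding sphere_partition_def by auto
  have R: "?R = (\<Union>e\<in>{1..E}. element th ph (s e) (t e))"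
    using partition unfolding sphere_partition_def by simp
  have "pairwise (\<lambda>e e'. negligible (element th ph (s e) (t e) \<inter> element th ph (s e') (t e'))) {1..E}"
  proof (intro pairwiseI negligible_Int_elements)
    fix e e' assume "e \<in> {1..E}" "e' \<in> {1..E}" "e \<noteq> e'"
    then show "interior (element th ph (s e) (t e)) \<inter> interior (element th ph (s e') (t e')) = {}"
      using partition unfolding sphere_partition_def by blast
  qed
  then have int: "(f has_integral ?rhs) ?R"
    unfolding R f_def by (intro has_integral_UN has_integral_element(1)[OF grid u refl]) auto
  \<comment> \<open>Absolute integrability allows the passage from the gauge integral to the
    Lebesgue integral in \<open>sphere_integral\<close>.\<close>
  have abs_int: "f absolutely_integrable_on ?R"
    unfolding R f_def by (intro absolutely_integrable_finite_UN has_integral_element(2)[OF grid u refl]) auto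
  \<comment> \<open>The elements fill the closed azimuthal range while
    \<open>sphere_integral\<close> uses the half-open one; the difference lies in a segment at
    azimuth 2 pi.\<close>
  have "?R - ?R' \<subseteq> cbox (0, 2 * pi) (pi, 2 * pi)" by (auto simp: cbox_Pair_eq)
  moreover have "negligible (cbox (0::real, 2 * pi) (pi, 2 * pi))"
    by (simp add: negligible_interval box_eq_empty Basis_prod_def)
  ultimately have neg: "negligible (?R - ?R')" by (rule negligible_subset[rotated])
  have abs_int': "f absolutely_integrable_on ?R'"
    by (rule absolutely_integrable_spike_set[OF abs_int])
      (auto intro: negligible_subset[OF neg] negligible_subset[OF negligible_empty])
  have "integral ?R' f = integral ?R f"
    by (rule integral_spike_set)
      (auto intro: negligible_subset[OF neg] negligible_subset[OF negligible_empty])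
  with int have "set_lebesgue_integral lebesgue ?R' f = ?rhs"
    using set_lebesgue_integral_eq_integral(2)[OF abs_int'] by (simp add: integral_unique)
  moreover have "f = (\<lambda>(x, y). (case (x, y) of (x, y) \<Rightarrow> u (x, y) * cnj (sph_harmonic l m x y)) * of_real (sin x))"
    by (auto simp: f_def)
  ultimately show ?thesis by (simp add: sph_coeff_def sphere_integral_def)
qed

text \<open>For odd \<open>m\<close> the function \<open>hatP l m (cos y)\<close> has the opposite
  sign to its trigonometric sum where sin y < 0. The formula for \<open>Q_int\<close> thus carries a
  sign condition, which holds on every element since its polar angles lie in [0, pi]; for arbitrary
  parameters it is stated with the analytic continuation in \<open>Q_int_angle\<close>.\<close>

theorem proposition3p1:
  fixes N E :: nat
    and xi th ph :: "nat \<Rightarrow> real"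
    and s t :: "nat \<Rightarrow> nat"
    and U :: "nat \<Rightarrow> nat \<Rightarrow> nat \<Rightarrow> complex"
    and u :: "real \<times> real \<Rightarrow> complex"
  assumes "1 \<le> N"
    and "bij_betw xi {0..N} (lgl_points N)"
    and "sphere_partition E th ph s t"
    and "\<And>e z. e \<in> {1..E} \<Longrightarrow> z \<in> interior (element th ph (s e) (t e)) \<Longrightarrow>
           u z = (\<Sum>i=0..N. \<Sum>j=0..N. U e i j *
                    of_real (nodal_basis N xi i j (element_map_inv th ph (s e) (t e) z)))"
  shows "(\<forall>l m. \<bar>m\<bar> \<le> int l \<longrightarrow>
            sph_coeff u l m =
              (\<Sum>e=1..E. \<Sum>i=0..N. \<Sum>j=0..N.
                 U e i j * azimuth_factor N xi ph m i (t e) * of_real (polar_factor N xi th l m j (s e))))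
       \<and> (\<forall>n l m lam rho. \<bar>m\<bar> \<le> int l \<longrightarrow>
            even m \<or> (\<forall>x\<in>{-1..1}. 0 \<le> sin (lam * x + rho)) \<longrightarrow>
            Q_int n l m lam rho = Q_formula n l m lam rho)
       \<and> (\<forall>n l m lam rho. \<bar>m\<bar> \<le> int l \<longrightarrow>
            Q_int_angle n l m lam rho = Q_formula n l m lam rho)"
proof (intro conjI allI impI)
  show "sph_coeff u l m =
      (\<Sum>e=1..E. \<Sum>i=0..N. \<Sum>j=0..N.
         U e i j * azimuth_factor N xi ph m i (t e) * of_real (polar_factor N xi th l m j (s e)))" for l m
    by (rule sph_coeff_eq) (use assms in auto)
qed (auto intro: Q_int_eq Q_int_angle_eq)

end
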